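(* Let $\mathbb{G}$ be a grid diagram, and let $A$ be the Alexander filtration level of $\mathbf{x}^+(\mathbb{G})$. Then, for each positive integer $i$: \begin{itemize} \item $n^+(\mathbb{G})=i<\infty$ if and only if $i$ is the smallest (positive) integer such that $$[\widetilde\partial\,\mathbf{x}^+(\mathbb{G})]\neq0\in H_*\bigl(\mathcal{F}_{A-1}\widetilde{\mathcal{GC}}(\mathbb{G})/\mathcal{F}_{A-i-1}\widetilde{\mathcal{GC}}(\mathbb{G})\bigr);$$ \item supposing $i<n^+(\mathbb{G})$, one has $\widetilde\lambda^+_i(\mathbb{G})=0$ if and only if $$[\mathbf{x}^+(\mathbb{G})]=0\in H_*\bigl(\mathcal{F}_{A+i-1}\widetilde{\mathcal{GC}}(\mathbb{G})/\mathcal{F}_{A-1}\widetilde{\mathcal{GC}}(\mathbb{G})\bigr).$$ \end{itemize} The analogous statements hold for $n^-(\mathbb{G})$ and $\widetilde\lambda^-_i(\mathbb{G})$, with $\mathbf{x}^-(\mathbb{G})$ and its Alexander filtration level in place of $\mathbf{x}^+(\mathbb{G})$ and $A$.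
   Context: Grid diagrams. A grid diagram $\mathbb{G}$ of size $m$ is an $m\times m$ planar grid with marker sets $\mathbb{O}=\{O_1,\dots,O_m\}$, $\mathbb{X}=\{X_1,\dots,X_m\}$, exactly one $O$ and one $X$ in each row and each column, and no cell containing more than one marker. It specifies an oriented link by joining $X$'s to $O$'s in each column and $O$'s to $X$'s in each row by oriented segments, vertical segments crossing over horizontal ones. Grid states. Identify opposite sides of the grid to get a torus, with horizontal circles $\boldsymbol\alpha$ and vertical circles $\boldsymbol\beta$. A grid state is an $m$-tuple $\mathbf{x}$ of intersection points with exactly one point on each horizontal and each vertical circle; $S(\mathbb{G})$ is the set of grid states. Regard $\mathbf{x}$ as a set of integer points in $[0,m)\times[0,m)$ and $\mathbb{O},\mathbb{X}$ as sets of half-integer points there. For finite $P,Q\subset\mathbb{R}^2$ let $\mathcal{I}(P,Q)$ be the number of $(p,q)\in P\times Q$ with $p$ strictly smaller than $q$ in both coordinates, and $\mathcal{J}(P,Q)=\frac12(\mathcal{I}(P,Q)+\mathcal{I}(Q,P))$. Set $M(\mathbf{x})=M_{\mathbb{O}}(\mathbf{x})=\mathcal{J}(\mathbf{x},\mathbf{x})-2\mathcal{J}(\mathbf{x},\mathbb{O})+\mathcal{J}(\mathbb{O},\mathbb{O})+1$, define $M_{\mathbb{X}}$ by the same formula with $\mathbb{X}$ in place of $\mathbb{O}$, and $A(\mathbf{x})=\frac12(M_{\mathbb{O}}(\mathbf{x})-M_{\mathbb{X}}(\mathbf{x}))-\frac{m-l}{2}$, where $l$ is the number of components of the link. Complex.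 For grid states $\mathbf{x},\mathbf{y}$ agreeing in exactly $m-2$ points, $\mathrm{Rect}(\mathbf{x},\mathbf{y})$ is the set of rectangles $r$ embedded in the torus with boundary on the horizontal and vertical circles, with vertex set $\mathbf{x}\triangle\mathbf{y}$, and with $\partial(\partial r\cap\boldsymbol\beta)=\mathbf{x}-\mathbf{y}$ in the induced orientation (i.e. the northeast and southwest corners of $r$ lie in $\mathbf{x}$); otherwise it is empty. $\mathrm{Rect}^\circ(\mathbf{x},\mathbf{y})$ consists of those $r$ with $\mathrm{Int}(r)\cap\mathbf{x}=\emptyset$. $\widetilde{\mathcal{GC}}(\mathbb{G})$ is the $\mathbb{F}_2$-vector space generated by $S(\mathbb{G})$ with (total) differential $\widetilde\partial(\mathbf{x})=\sum_{\mathbf{y}}\#\{r\in\mathrm{Rect}^\circ(\mathbf{x},\mathbf{y}): r\cap\mathbb{O}=\emptyset\}\,\mathbf{y}$, homological grading $M$, and increasing filtration $\mathcal{F}_p\widetilde{\mathcal{GC}}(\mathbb{G})$ spanned by the states with $A\le p$ (the Alexander filtration). Spectral sequence. For a complex $C$ with bounded increasing filtration $\mathcal{F}$, $E^r_p=Z^r_p/B^r_p$ with $Z^r_p=\frac{\mathcal{F}_pC\cap\partial^{-1}(\mathcal{F}_{p-r}C)+\mathcal{F}_{p-1}C}{\mathcal{F}_{p-1}C}$, $B^r_p=\frac{\mathcal{F}_pC\cap\partial(\mathcal{F}_{p+r-1}C)+\mathcal{F}_{p-1}C}{\mathcal{F}_{p-1}C}$, and $d^r\colon E^r_p\to E^r_{p-r}$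 induced by $\partial$. If $x\in\mathcal{F}_pC\cap\partial^{-1}(\mathcal{F}_{p-r}C)+\mathcal{F}_{p-1}C$ (where $p$ is the filtration level of $x$), $[x]^r\in E^r_p$ is its class; $[x]^{r+1}$ is defined iff $d^r[x]^r=0$. Invariants. $\mathbf{x}^+(\mathbb{G})$ (resp. $\mathbf{x}^-(\mathbb{G})$) is the grid state of all points at the northeast (resp. southwest) corners of the cells containing the $X$'s; both are cycles in the associated graded complex. $n^\pm(\mathbb{G})$ is the smallest integer $i\ge1$ with $d^i[\mathbf{x}^\pm(\mathbb{G})]^i\ne0$, or $\infty$ if there is none. For integers $1\le i\le n^\pm(\mathbb{G})$, $\widetilde\lambda^\pm_i(\mathbb{G})=[\mathbf{x}^\pm(\mathbb{G})]^i\in E^i_{A(\mathbf{x}^\pm(\mathbb{G}))}(\widetilde{\mathcal{GC}}(\mathbb{G}))$. *)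

theory Defs
  imports
    Complex_Main
    "HOL-Library.Poly_Mapping"
    "HOL-Library.Z2"
    "HOL-Library.Extended_Nat"
    "HOL-Algebra.Coset"
begin

section \<open>Grid diagrams\<close>

text \<open>
  Cells and lattice points are both addressed by pairs \<open>(column, row)\<close> in \<open>{..<m} \<times> {..<m}\<close>:
  the cell \<open>(i, j)\<close> is the square \<open>[i, i + 1] \<times> [j, j + 1]\<close>, so a marker in it sits at
  \<open>(i + 1/2, j + 1/2)\<close>, and \<open>(i, j)\<close> is also its southwest corner. On the torus
  coordinates are read modulo \<open>m\<close>.
\<close>

definition one_per_line :: "nat \<Rightarrow> (nat \<times> nat) set \<Rightarrow> bool" where
  "one_per_line m P \<longleftrightarrow>
     P \<subseteq> {..<m} \<times> {..<m} \<and>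
     (\<forall>i<m. \<exists>!j. (i, j) \<in> P) \<and>
     (\<forall>j<m. \<exists>!i. (i, j) \<in> P)"

record grid =
  grid_size :: nat
  Os :: "(nat \<times> nat) set"
  Xs :: "(nat \<times> nat) set"

definition grid_diagram :: "grid \<Rightarrow> bool" where
  "grid_diagram G \<longleftrightarrow>
     0 < grid_size G \<and>
     one_per_line (grid_size G) (Os G) \<and>
     one_per_line (grid_size G) (Xs G) \<and>
     Os G \<inter> Xs G = {}"

definition link_segments :: "grid \<Rightarrow> ((nat \<times> nat) \<times> (nat \<times> nat)) set" where
  "link_segments G =
     {(p, q). p \<in> Xs G \<and> q \<in> Os G \<and> fst p = fst q} \<union>
     {(p, q). p \<in> Os G \<and> q \<in> Xs G \<and> snd p = snd q}"

definition link_components :: "grid \<Rightarrow> nat" where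
  "link_components G =
     card ((Os G \<union> Xs G) // (link_segments G \<union> (link_segments G)\<inverse>)\<^sup>*)"


section \<open>Grid states and gradings\<close>

definition grid_states :: "grid \<Rightarrow> (nat \<times> nat) set set" where
  "grid_states G = {x. one_per_line (grid_size G) x}"

definition state_points :: "(nat \<times> nat) set \<Rightarrow> (real \<times> real) set" where
  "state_points x = (\<lambda>(i, j). (real i, real j)) ` x"

definition marker_points :: "(nat \<times> nat) set \<Rightarrow> (real \<times> real) set" where
  "marker_points P = (\<lambda>(i, j). (real i + 1 / 2, real j + 1 / 2)) ` P"

definition I_count :: "(real \<times> real) set \<Rightarrow> (real \<times> real) set \<Rightarrow> nat" where
  "I_count P Q = card {(p, q). p \<in> P \<and> q \<in> Q \<and> fst p < fst q \<and> snd p < snd q}"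

definition J_count :: "(real \<times> real) set \<Rightarrow> (real \<times> real) set \<Rightarrow> real" where
  "J_count P Q = (real (I_count P Q) + real (I_count Q P)) / 2"

definition maslov_wrt :: "(nat \<times> nat) set \<Rightarrow> (nat \<times> nat) set \<Rightarrow> real" where
  "maslov_wrt P x =
     J_count (state_points x) (state_points x)
     - 2 * J_count (state_points x) (marker_points P)
     + J_count (marker_points P) (marker_points P) + 1"

definition alexander :: "grid \<Rightarrow> (nat \<times> nat) set \<Rightarrow> real" where
  "alexander G x =
     (maslov_wrt (Os G) x - maslov_wrt (Xs G) x) / 2
     - (real (grid_size G) - real (link_components G)) / 2"


section \<open>Rectangles on the torus\<close>

text \<open>
  An embedded rectangle with boundary on the circles and four distinct vertices is given by its
  southwest corner together with its width and height, both strictly between \<open>0\<close> and \<open>m\<close>.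
\<close>

record rectangle =
  left :: nat
  bottom :: nat
  width :: nat
  height :: nat

definition torus_point :: "grid \<Rightarrow> nat \<Rightarrow> nat \<Rightarrow> nat \<times> nat" where
  "torus_point G i j = (i mod grid_size G, j mod grid_size G)"

definition torus_rectangle :: "grid \<Rightarrow> rectangle \<Rightarrow> bool" where
  "torus_rectangle G r \<longleftrightarrow>
     left r < grid_size G \<and> bottom r < grid_size G \<and>
     0 < width r \<and> width r < grid_size G \<and>
     0 < height r \<and> height r < grid_size G"

definition sw_corner :: "grid \<Rightarrow> rectangle \<Rightarrow> nat \<times> nat" where
  "sw_corner G r = torus_point G (left r) (bottom r)"

definition se_corner :: "grid \<Rightarrow> rectangle \<Rightarrow> nat \<times> nat" where
  "se_corner G r = torus_point G (left r + width r) (bottom r)"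

definition nw_corner :: "grid \<Rightarrow> rectangle \<Rightarrow> nat \<times> nat" where
  "nw_corner G r = torus_point G (left r) (bottom r + height r)"

definition ne_corner :: "grid \<Rightarrow> rectangle \<Rightarrow> nat \<times> nat" where
  "ne_corner G r = torus_point G (left r + width r) (bottom r + height r)"

definition rect_cells :: "grid \<Rightarrow> rectangle \<Rightarrow> (nat \<times> nat) set" where
  "rect_cells G r =
     {torus_point G (left r + i) (bottom r + j) | i j. i < width r \<and> j < height r}"

definition rect_interior_points :: "grid \<Rightarrow> rectangle \<Rightarrow> (nat \<times> nat) set" where
  "rect_interior_points G r =
     {torus_point G (left r + i) (bottom r + j) | i j.
        0 < i \<and> i < width r \<and> 0 < j \<and> j < height r}"

definition rects :: "grid \<Rightarrow> (nat \<times> nat) set \<Rightarrow> (nat \<times> nat) set \<Rightarrow> rectangle set" where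
  "rects G x y =
     {r. 2 \<le> grid_size G \<and> card (x \<inter> y) = grid_size G - 2 \<and> torus_rectangle G r \<and>
         {sw_corner G r, se_corner G r, nw_corner G r, ne_corner G r} = (x - y) \<union> (y - x) \<and>
         ne_corner G r \<in> x \<and> sw_corner G r \<in> x}"

definition empty_rects :: "grid \<Rightarrow> (nat \<times> nat) set \<Rightarrow> (nat \<times> nat) set \<Rightarrow> rectangle set" where
  "empty_rects G x y = {r \<in> rects G x y. rect_interior_points G r \<inter> x = {}}"


section \<open>The filtered grid complex\<close>

text \<open>
  Vector spaces over the field \<^typ>\<open>bit\<close> with two elements enter only through their additive
  groups, which are written multiplicatively (product \<open>(+)\<close>, unit \<open>0\<close>), as for the chain and
  homology groups of \<open>HOL-Homology\<close>. Thus \<open>= \<one>\<close> in a quotient means that a class vanishes.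
\<close>

type_synonym chain = "(nat \<times> nat) set \<Rightarrow>\<^sub>0 bit"

definition grid_chains :: "grid \<Rightarrow> chain monoid" where
  "grid_chains G =
     \<lparr>carrier = {c. Poly_Mapping.keys c \<subseteq> grid_states G}, mult = (+), one = 0\<rparr>"

definition state_diff :: "grid \<Rightarrow> (nat \<times> nat) set \<Rightarrow> chain" where
  "state_diff G x =
     (\<Sum>y\<in>grid_states G.
        Poly_Mapping.single y
          (of_nat (card {r \<in> empty_rects G x y. rect_cells G r \<inter> Os G = {}})))"

text \<open>The linear extension; a nonzero coefficient in \<^typ>\<open>bit\<close> is \<open>1\<close>.\<close>

definition grid_diff :: "grid \<Rightarrow> chain \<Rightarrow> chain" where
  "grid_diff G c = (\<Sum>x\<in>Poly_Mapping.keys c. state_diff G x)"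

definition state_chain :: "(nat \<times> nat) set \<Rightarrow> chain" where
  "state_chain x = Poly_Mapping.single x 1"

text \<open>
  The level \<open>p\<close> ranges over the reals because \<^const>\<open>alexander\<close> is real-valued by its formula.
  As its values are integers, the level \<open>p\<close> agrees with the level \<open>\<lfloor>p\<rfloor>\<close>.
\<close>

definition alexander_filtration :: "grid \<Rightarrow> real \<Rightarrow> chain set" where
  "alexander_filtration G p =
     {c \<in> carrier (grid_chains G). \<forall>x \<in> Poly_Mapping.keys c. alexander G x \<le> p}"


section \<open>Quotients, homology and the spectral sequence of a filtered complex\<close>

definition quotient_group :: "('a, 'b) monoid_scheme \<Rightarrow> 'a set \<Rightarrow> 'a set \<Rightarrow> 'a set monoid" where
  "quotient_group C V W = (C\<lparr>carrier := V\<rparr>) Mod W"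

text \<open>
  The map that \<open>f\<close>, on representatives taken from \<open>D\<close>, induces between quotients with class
  maps \<open>cl\<close> and \<open>cl'\<close>.
\<close>

definition induced_map :: "'a set \<Rightarrow> ('a \<Rightarrow> 'q) \<Rightarrow> ('b \<Rightarrow> 's) \<Rightarrow> ('a \<Rightarrow> 'b) \<Rightarrow> 'q \<Rightarrow> 's" where
  "induced_map D cl cl' f q = (THE q'. \<exists>c\<in>D. q = cl c \<and> q' = cl' (f c))"

definition homology :: "('a, 'b) monoid_scheme \<Rightarrow> ('a \<Rightarrow> 'a) \<Rightarrow> 'a set monoid" where
  "homology K d = quotient_group K (kernel K K d) (d ` carrier K)"

definition homology_class :: "('a, 'b) monoid_scheme \<Rightarrow> ('a \<Rightarrow> 'a) \<Rightarrow> 'a \<Rightarrow> 'a set" where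
  "homology_class K d z = (d ` carrier K) #>\<^bsub>K\<^esub> z"

text \<open>The differential of the quotient complex \<open>V / W\<close>.\<close>

definition quotient_diff ::
  "('a, 'b) monoid_scheme \<Rightarrow> ('a \<Rightarrow> 'a) \<Rightarrow> 'a set \<Rightarrow> 'a set \<Rightarrow> 'a set \<Rightarrow> 'a set" where
  "quotient_diff C d V W = induced_map V (\<lambda>c. W #>\<^bsub>C\<^esub> c) (\<lambda>c. W #>\<^bsub>C\<^esub> c) d"

definition quotient_homology ::
  "('a, 'b) monoid_scheme \<Rightarrow> ('a \<Rightarrow> 'a) \<Rightarrow> 'a set \<Rightarrow> 'a set \<Rightarrow> 'a set set monoid" where
  "quotient_homology C d V W = homology (quotient_group C V W) (quotient_diff C d V W)"

definition quotient_homology_class ::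
  "('a, 'b) monoid_scheme \<Rightarrow> ('a \<Rightarrow> 'a) \<Rightarrow> 'a set \<Rightarrow> 'a set \<Rightarrow> 'a \<Rightarrow> 'a set set" where
  "quotient_homology_class C d V W c =
     homology_class (quotient_group C V W) (quotient_diff C d V W) (W #>\<^bsub>C\<^esub> c)"

definition Z_num ::
  "('a, 'b) monoid_scheme \<Rightarrow> ('a \<Rightarrow> 'a) \<Rightarrow> (real \<Rightarrow> 'a set) \<Rightarrow> nat \<Rightarrow> real \<Rightarrow> 'a set" where
  "Z_num C d F r p = {c \<in> F p. d c \<in> F (p - real r)} <#>\<^bsub>C\<^esub> F (p - 1)"

definition B_num ::
  "('a, 'b) monoid_scheme \<Rightarrow> ('a \<Rightarrow> 'a) \<Rightarrow> (real \<Rightarrow> 'a set) \<Rightarrow> nat \<Rightarrow> real \<Rightarrow> 'a set" where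
  "B_num C d F r p = (F p \<inter> d ` F (p + real r - 1)) <#>\<^bsub>C\<^esub> F (p - 1)"

definition Z_page ::
  "('a, 'b) monoid_scheme \<Rightarrow> ('a \<Rightarrow> 'a) \<Rightarrow> (real \<Rightarrow> 'a set) \<Rightarrow> nat \<Rightarrow> real \<Rightarrow> 'a set monoid" where
  "Z_page C d F r p = quotient_group C (Z_num C d F r p) (F (p - 1))"

definition B_page ::
  "('a, 'b) monoid_scheme \<Rightarrow> ('a \<Rightarrow> 'a) \<Rightarrow> (real \<Rightarrow> 'a set) \<Rightarrow> nat \<Rightarrow> real \<Rightarrow> 'a set monoid" where
  "B_page C d F r p = quotient_group C (B_num C d F r p) (F (p - 1))"

definition E_page ::
  "('a, 'b) monoid_scheme \<Rightarrow> ('a \<Rightarrow> 'a) \<Rightarrow> (real \<Rightarrow> 'a set) \<Rightarrow> nat \<Rightarrow> real \<Rightarrow> 'a set set monoid" where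
  "E_page C d F r p = Z_page C d F r p Mod carrier (B_page C d F r p)"

definition E_class ::
  "('a, 'b) monoid_scheme \<Rightarrow> ('a \<Rightarrow> 'a) \<Rightarrow> (real \<Rightarrow> 'a set) \<Rightarrow> nat \<Rightarrow> real \<Rightarrow> 'a \<Rightarrow> 'a set set" where
  "E_class C d F r p c =
     carrier (B_page C d F r p) #>\<^bsub>Z_page C d F r p\<^esub> (F (p - 1) #>\<^bsub>C\<^esub> c)"

text \<open>
  \<open>\<partial>\<close> induces \<open>d\<^sup>r : E\<^sup>r\<^sub>p \<rightarrow> E\<^sup>r\<^sub>p\<^sub>-\<^sub>r\<close> through the representatives \<open>c\<close> with \<open>\<partial> c\<close> in level \<open>p - r\<close>;
  each element of \<open>E\<^sup>r\<^sub>p\<close> has such a representative.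
\<close>

definition E_diff ::
  "('a, 'b) monoid_scheme \<Rightarrow> ('a \<Rightarrow> 'a) \<Rightarrow> (real \<Rightarrow> 'a set) \<Rightarrow> nat \<Rightarrow> real
     \<Rightarrow> 'a set set \<Rightarrow> 'a set set" where
  "E_diff C d F r p =
     induced_map {c \<in> F p. d c \<in> F (p - real r)}
       (E_class C d F r p) (E_class C d F r (p - real r)) d"

text \<open>
  The class of \<open>c\<close> on page \<open>i\<close> is defined exactly if \<open>c \<in> Z_num C d F i p\<close>. The infimum of the
  empty set in \<^typ>\<open>enat\<close> is \<open>\<infinity>\<close>.
\<close>

definition first_nonzero_diff ::
  "('a, 'b) monoid_scheme \<Rightarrow> ('a \<Rightarrow> 'a) \<Rightarrow> (real \<Rightarrow> 'a set) \<Rightarrow> real \<Rightarrow> 'a \<Rightarrow> enat" where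
  "first_nonzero_diff C d F p c =
     Inf {enat i | i. 1 \<le> i \<and> c \<in> Z_num C d F i p \<and>
       E_diff C d F i p (E_class C d F i p c) \<noteq> \<one>\<^bsub>E_page C d F i (p - real i)\<^esub>}"


section \<open>The invariants\<close>

definition x_plus :: "grid \<Rightarrow> (nat \<times> nat) set" where
  "x_plus G = (\<lambda>(i, j). torus_point G (i + 1) (j + 1)) ` Xs G"

definition x_minus :: "grid \<Rightarrow> (nat \<times> nat) set" where
  "x_minus G = (\<lambda>(i, j). torus_point G i j) ` Xs G"

definition grid_E :: "grid \<Rightarrow> nat \<Rightarrow> real \<Rightarrow> chain set set monoid" where
  "grid_E G = E_page (grid_chains G) (grid_diff G) (alexander_filtration G)"

definition grid_H :: "grid \<Rightarrow> real \<Rightarrow> real \<Rightarrow> chain set set monoid" where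
  "grid_H G a b = quotient_homology (grid_chains G) (grid_diff G)
     (alexander_filtration G a) (alexander_filtration G b)"

definition grid_H_class :: "grid \<Rightarrow> real \<Rightarrow> real \<Rightarrow> chain \<Rightarrow> chain set set" where
  "grid_H_class G a b = quotient_homology_class (grid_chains G) (grid_diff G)
     (alexander_filtration G a) (alexander_filtration G b)"

definition n_plus :: "grid \<Rightarrow> enat" where
  "n_plus G = first_nonzero_diff (grid_chains G) (grid_diff G) (alexander_filtration G)
     (alexander G (x_plus G)) (state_chain (x_plus G))"

definition n_minus :: "grid \<Rightarrow> enat" where
  "n_minus G = first_nonzero_diff (grid_chains G) (grid_diff G) (alexander_filtration G)
     (alexander G (x_minus G)) (state_chain (x_minus G))"

text \<open>Meaningful only for \<open>1 \<le> i \<le> n\<^sup>\<plusminus>\<close>, where the classes are defined.\<close>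

definition lambda_plus :: "grid \<Rightarrow> nat \<Rightarrow> chain set set" where
  "lambda_plus G i = E_class (grid_chains G) (grid_diff G) (alexander_filtration G) i
     (alexander G (x_plus G)) (state_chain (x_plus G))"

definition lambda_minus :: "grid \<Rightarrow> nat \<Rightarrow> chain set set" where
  "lambda_minus G i = E_class (grid_chains G) (grid_diff G) (alexander_filtration G) i
     (alexander G (x_minus G)) (state_chain (x_minus G))"

end

theory Submission
  imports Defs
begin

text \<open>
  For a filtered complex put \<open>B a b = \<partial> (F a) + F b\<close>. If \<open>x\<close> has level \<open>A\<close> and \<open>\<partial> x\<close> has level
  \<open>A - 1\<close>, then \<open>x\<close> survives to page \<open>i\<close> iff \<open>\<partial> x \<in> B (A - 1) (A - i)\<close>: correct \<open>x\<close> by a chain of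
  level \<open>A - 1\<close>. On that page, \<open>d\<^sup>i [x]\<close> vanishes iff \<open>\<partial> x \<in> B (A - 1) (A - i - 1)\<close>, which is the
  vanishing of the homology class of \<open>\<partial> x\<close>. Likewise \<open>[x]\<close> vanishes on page \<open>i\<close> iff
  \<open>x \<in> B (A + i - 1) (A - 1)\<close>.

  It remains to see that the grid complex is a filtered complex and that \<open>\<partial> x\<^sup>\<plusminus>\<close> drops a level.
  For \<open>\<partial>\<^sup>2 = 0\<close> the domain of a pair of successive rectangles can be cut in exactly one other way,
  annuli being excluded because they contain an \<open>O\<close>. Along a rectangle the Alexander grading drops
  by the number of \<open>X\<close>'s minus the number of \<open>O\<close>'s in it, and a rectangle leaving \<open>x\<^sup>+\<close> or \<open>x\<^sup>-\<close>
  has an \<open>X\<close> in its northeast or southwest corner cell.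
\<close>

section \<open>Homology of filtered complexes\<close>

definition add_subgroup :: "'a::ab_group_add set \<Rightarrow> bool" where
  "add_subgroup W \<longleftrightarrow> 0 \<in> W \<and> (\<forall>a\<in>W. \<forall>b\<in>W. a - b \<in> W)"

definition coset :: "'a::ab_group_add set \<Rightarrow> 'a \<Rightarrow> 'a set" where
  "coset W c = (\<lambda>w. w + c) ` W"

lemma add_subgroup_0: "add_subgroup W \<Longrightarrow> 0 \<in> W"
  and add_subgroup_diff: "add_subgroup W \<Longrightarrow> a \<in> W \<Longrightarrow> b \<in> W \<Longrightarrow> a - b \<in> W"
  by (auto simp: add_subgroup_def)

lemma add_subgroup_minus: "add_subgroup W \<Longrightarrow> a \<in> W \<Longrightarrow> - a \<in> W"
  using add_subgroup_diff[of W 0 a] add_subgroup_0[of W] by simp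

lemma add_subgroup_add: "add_subgroup W \<Longrightarrow> a \<in> W \<Longrightarrow> b \<in> W \<Longrightarrow> a + b \<in> W"
  using add_subgroup_diff[of W a "- b"] add_subgroup_minus[of W b] by simp

lemma mem_coset: "a \<in> coset W b \<longleftrightarrow> a - b \<in> W"
  unfolding coset_def by (auto intro!: image_eqI[where x="a - b"])

lemma coset_eq_iff:
  assumes "add_subgroup W"
  shows "coset W a = coset W b \<longleftrightarrow> a - b \<in> W"
proof
  assume "coset W a = coset W b"
  moreover have "a \<in> coset W a"
    using assms by (simp add: mem_coset add_subgroup_0)
  ultimately show "a - b \<in> W"
    by (simp add: mem_coset)
next
  assume ab: "a - b \<in> W"
  have "u - a \<in> W \<longleftrightarrow> u - b \<in> W" for u
    using add_subgroup_add[OF assms _ ab, of "u - a"] add_subgroup_diff[OF assms _ ab, of "u - b"]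
    by auto
  then show "coset W a = coset W b"
    by (auto simp: mem_coset)
qed

text \<open>The union on the left is the unfolded product of two cosets in a factor group, so this
  is addition in the quotient.\<close>

lemma coset_add:
  assumes "add_subgroup W"
  shows "(\<Union>u\<in>coset W a. \<Union>v\<in>coset W b. {u + v}) = coset W (a + b)"
proof (intro Set.set_eqI iffI)
  fix z assume "z \<in> (\<Union>u\<in>coset W a. \<Union>v\<in>coset W b. {u + v})"
  then obtain u v where "u - a \<in> W" "v - b \<in> W" "z = u + v"
    by (auto simp: mem_coset)
  then show "z \<in> coset W (a + b)"
    using add_subgroup_add[OF assms, of "u - a" "v - b"] by (simp add: mem_coset algebra_simps)
next
  fix z assume "z \<in> coset W (a + b)"
  then have "z - b \<in> coset W a" "b \<in> coset W b" "z = (z - b) + b"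
    using assms by (auto simp: mem_coset algebra_simps add_subgroup_0)
  then show "z \<in> (\<Union>u\<in>coset W a. \<Union>v\<in>coset W b. {u + v})"
    by blast
qed

section \<open>Iterated quotients, written multiplicatively, of additive groups\<close>

locale additive_monoid =
  fixes C :: "'a::ab_group_add monoid"
  assumes mult_C: "x \<otimes>\<^bsub>C\<^esub> y = x + y"
begin

lemma r_coset_C: "W #>\<^bsub>C\<^esub> c = coset W c"
  by (auto simp: r_coset_def coset_def mult_C)

lemma set_mult_C: "V <#>\<^bsub>C\<^esub> W = (\<Union>u\<in>V. \<Union>v\<in>W. {u + v})"
  by (auto simp: set_mult_def mult_C)

lemma quotient_group_carrier: "carrier (quotient_group C V W) = coset W ` V"
  by (auto simp: quotient_group_def FactGroup_def RCOSETS_def r_coset_def coset_def mult_C)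

lemma quotient_group_mult:
  assumes "add_subgroup W"
  shows "coset W a \<otimes>\<^bsub>quotient_group C V W\<^esub> coset W b = coset W (a + b)"
  by (simp add: quotient_group_def FactGroup_def set_mult_def mult_C coset_add[OF assms])

text \<open>Homology groups and pages are quotients of quotients. A class there is the set of
  \<open>W\<close>-cosets of the members of one \<open>B\<close>-coset of chains.\<close>

lemma quotient_group_r_coset:
  assumes "add_subgroup W"
  shows "coset W ` B #>\<^bsub>quotient_group C V W\<^esub> coset W c = coset W ` coset B c"
proof -
  have "coset W ` B #>\<^bsub>quotient_group C V W\<^esub> coset W c = (\<lambda>b. coset W (b + c)) ` B"
    by (auto simp: r_coset_def quotient_group_mult[OF assms])
  then show ?thesis
    by (simp add: coset_def[of B] image_image)
qed

text \<open>The third isomorphism theorem on elements: because \<open>W\<close> lies in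
  \<open>B\<close>, classes modulo \<open>B/W\<close> are told apart by \<open>B\<close>
  alone.\<close>

lemma quotient_class_eq_iff:
  assumes "add_subgroup W" "add_subgroup B" "W \<subseteq> B"
  shows "coset W ` coset B a = coset W ` coset B b \<longleftrightarrow> a - b \<in> B"
proof
  assume eq: "coset W ` coset B a = coset W ` coset B b"
  have "a \<in> coset B a"
    using assms by (simp add: mem_coset add_subgroup_0)
  then have "coset W a \<in> coset W ` coset B b"
    using eq by blast
  then obtain u where "u - b \<in> B" "a - u \<in> W"
    by (auto simp: mem_coset coset_eq_iff[OF assms(1)])
  then show "a - b \<in> B"
    using add_subgroup_add[OF assms(2), of "a - u" "u - b"] assms(3) by auto
next
  assume "a - b \<in> B"
  then show "coset W ` coset B a = coset W ` coset B b"
    by (metis coset_eq_iff[OF assms(2)])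
qed

end

text \<open>\<open>d_F\<close> and \<open>d_d\<close> speak only of chains of some level, since an
  element of the type \<open>chain\<close> may involve sets that are not grid states.\<close>

locale filtered_complex = additive_monoid C
  for C :: "'a::ab_group_add monoid" +
  fixes d :: "'a \<Rightarrow> 'a" and F :: "real \<Rightarrow> 'a set"
  assumes F_subgroup: "add_subgroup (F p)"
    and F_mono: "p \<le> q \<Longrightarrow> F p \<subseteq> F q"
    and d_diff: "d (a - b) = d a - d b"
    and d_F: "c \<in> F p \<Longrightarrow> d c \<in> F p"
    and d_d: "c \<in> F p \<Longrightarrow> d (d c) = 0"
begin

lemma d_0: "d 0 = 0"
  using d_diff[of 0 0] by simp

lemma d_add: "d (a + b) = d a + d b"
  using d_diff[of a "- b"] d_diff[of 0 b] d_0 by simp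

text \<open>All conditions compared in the theorem are membership statements about these subgroups.\<close>

definition boundaries :: "real \<Rightarrow> real \<Rightarrow> 'a set" where
  "boundaries a b = {u. \<exists>c\<in>F a. u - d c \<in> F b}"

lemma add_subgroup_sum_F:
  assumes "add_subgroup V"
  shows "add_subgroup (\<Union>u\<in>V. \<Union>v\<in>F p. {u + v})"
  unfolding add_subgroup_def
proof (intro conjI ballI)
  show "0 \<in> (\<Union>u\<in>V. \<Union>v\<in>F p. {u + v})"
    using add_subgroup_0[OF assms] add_subgroup_0[OF F_subgroup, of p] by force
next
  fix x y assume "x \<in> (\<Union>u\<in>V. \<Union>v\<in>F p. {u + v})" "y \<in> (\<Union>u\<in>V. \<Union>v\<in>F p. {u + v})"
  then obtain u v u' v' where *: "u \<in> V" "v \<in> F p" "x = u + v" "u' \<in> V" "v' \<in> F p" "y = u' + v'"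
    by auto
  then have "x - y = (u - u') + (v - v')" "u - u' \<in> V" "v - v' \<in> F p"
    using assms F_subgroup by (auto simp: add_subgroup_diff)
  then show "x - y \<in> (\<Union>u\<in>V. \<Union>v\<in>F p. {u + v})"
    by blast
qed

lemma add_subgroup_boundaries: "add_subgroup (boundaries a b)"
  unfolding add_subgroup_def
proof (intro conjI ballI)
  show "0 \<in> boundaries a b"
    using F_subgroup d_0 by (auto simp: boundaries_def intro!: bexI[of _ 0] add_subgroup_0)
next
  fix x y assume "x \<in> boundaries a b" "y \<in> boundaries a b"
  then obtain c c' where *: "c \<in> F a" "x - d c \<in> F b" "c' \<in> F a" "y - d c' \<in> F b"
    by (auto simp: boundaries_def)
  have "(x - y) - d (c - c') = (x - d c) - (y - d c')"
    by (simp add: d_diff)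
  then show "x - y \<in> boundaries a b"
    using * add_subgroup_diff[OF F_subgroup]
    unfolding boundaries_def by (metis (mono_tags, lifting) mem_Collect_eq)
qed

lemma F_subset_boundaries: "F b \<subseteq> boundaries a b"
  using F_subgroup d_0 by (auto simp: boundaries_def intro!: bexI[of _ 0] add_subgroup_0)

section \<open>Homology of the quotient of two levels\<close>

lemma quotient_homology_one:
  "\<one>\<^bsub>quotient_homology C d (F a) (F b)\<^esub> = quotient_diff C d (F a) (F b) ` coset (F b) ` F a"
  by (simp add: quotient_homology_def homology_def quotient_group_def[of "quotient_group C (F a) (F b)"]
      FactGroup_def quotient_group_carrier)

text \<open>Another representative differs by an element of \<open>F b\<close>, which
  \<open>d\<close> keeps in \<open>F b\<close>; so the value described by \<open>induced_map\<close>
  is unique.\<close>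

lemma quotient_diff_coset:
  assumes "c \<in> F a"
  shows "quotient_diff C d (F a) (F b) (coset (F b) c) = coset (F b) (d c)"
  unfolding quotient_diff_def induced_map_def r_coset_C
proof (rule the_equality)
  show "\<exists>ca\<in>F a. coset (F b) c = coset (F b) ca \<and> coset (F b) (d c) = coset (F b) (d ca)"
    using assms by blast
next
  fix q' assume "\<exists>ca\<in>F a. coset (F b) c = coset (F b) ca \<and> q' = coset (F b) (d ca)"
  then obtain c' where "c - c' \<in> F b" and q': "q' = coset (F b) (d c')"
    by (auto simp: coset_eq_iff[OF F_subgroup])
  then have "d c - d c' \<in> F b"
    using d_F by (metis d_diff)
  then show "q' = coset (F b) (d c)"
    unfolding q' using coset_eq_iff[OF F_subgroup] by metis
qed

text \<open>Adding \<open>F b\<close> to a boundary does not change its coset. The coset of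
  \<open>0\<close> is written out so that \<open>quotient_class_eq_iff\<close> applies.\<close>

lemma image_quotient_diff:
  "quotient_diff C d (F a) (F b) ` coset (F b) ` F a = coset (F b) ` coset (boundaries a b) 0"
proof -
  have "quotient_diff C d (F a) (F b) ` coset (F b) ` F a = (\<lambda>c. coset (F b) (d c)) ` F a"
    by (simp add: image_image quotient_diff_coset)
  also have "\<dots> = coset (F b) ` boundaries a b"
  proof (intro Set.set_eqI iffI)
    fix q assume "q \<in> (\<lambda>c. coset (F b) (d c)) ` F a"
    then show "q \<in> coset (F b) ` boundaries a b"
      by (force simp: boundaries_def add_subgroup_0 F_subgroup)
  next
    fix q assume "q \<in> coset (F b) ` boundaries a b"
    then show "q \<in> (\<lambda>c. coset (F b) (d c)) ` F a"
      by (auto simp: boundaries_def coset_eq_iff[OF F_subgroup])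
  qed
  finally show ?thesis
    by (simp add: coset_def)
qed

lemma quotient_homology_class_eq_one_iff:
  "quotient_homology_class C d (F a) (F b) c = \<one>\<^bsub>quotient_homology C d (F a) (F b)\<^esub>
     \<longleftrightarrow> c \<in> boundaries a b"
proof -
  have "quotient_homology_class C d (F a) (F b) c = coset (F b) ` coset (boundaries a b) c"
    by (simp only: quotient_homology_class_def homology_class_def quotient_group_carrier r_coset_C
        image_quotient_diff quotient_group_r_coset[OF F_subgroup]) (simp add: coset_def)
  then show ?thesis
    using quotient_class_eq_iff[OF F_subgroup add_subgroup_boundaries F_subset_boundaries, of b a c 0]
    by (simp add: quotient_homology_one image_quotient_diff)
qed

section \<open>Pages of the spectral sequence\<close>

lemma mem_Z_num:
  "c \<in> Z_num C d F r p \<longleftrightarrow>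
     (\<exists>e\<in>F (p - 1). c - e \<in> F p \<and> d (c - e) \<in> F (p - real r))"
  unfolding Z_num_def set_mult_C by (auto 4 4 intro: bexI[of _ "c - _"])

lemma mem_B_num:
  "c \<in> B_num C d F r p \<longleftrightarrow>
     (\<exists>b\<in>F (p + real r - 1). d b \<in> F p \<and> c - d b \<in> F (p - 1))"
  unfolding B_num_def set_mult_C by (auto 4 4 intro: bexI[of _ "c - _"])

lemma add_subgroup_B_num: "add_subgroup (B_num C d F r p)"
  unfolding B_num_def set_mult_C
proof (rule add_subgroup_sum_F)
  show "add_subgroup (F p \<inter> d ` F (p + real r - 1))"
    unfolding add_subgroup_def
  proof (intro conjI ballI)
    show "0 \<in> F p \<inter> d ` F (p + real r - 1)"
      using F_subgroup by (auto simp: d_0 add_subgroup_0 intro!: image_eqI[of _ d 0])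
    fix x y assume "x \<in> F p \<inter> d ` F (p + real r - 1)" "y \<in> F p \<inter> d ` F (p + real r - 1)"
    then obtain b b' where xy: "x \<in> F p" "y \<in> F p" and x: "x = d b" and y: "y = d b'"
      and "b \<in> F (p + real r - 1)" "b' \<in> F (p + real r - 1)"
      by blast
    moreover have "x - y = d (b - b')"
      unfolding x y by (rule d_diff[symmetric])
    moreover have "x - y \<in> F p"
      using xy by (rule add_subgroup_diff[OF F_subgroup])
    ultimately show "x - y \<in> F p \<inter> d ` F (p + real r - 1)"
      using add_subgroup_diff[OF F_subgroup] by auto
  qed
qed

lemma F_subset_B_num: "F (p - 1) \<subseteq> B_num C d F r p"
proof
  fix c assume "c \<in> F (p - 1)"
  then show "c \<in> B_num C d F r p"
    unfolding mem_B_num using F_subgroup d_0 by (intro bexI[of _ 0]) (auto simp: add_subgroup_0)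
qed

lemma E_class_eq: "E_class C d F r p c = coset (F (p - 1)) ` coset (B_num C d F r p) c"
  by (simp add: E_class_def B_page_def Z_page_def quotient_group_carrier r_coset_C
      quotient_group_r_coset[OF F_subgroup])

lemma E_class_eq_iff:
  "E_class C d F r p c = E_class C d F r p c' \<longleftrightarrow> c - c' \<in> B_num C d F r p"
  unfolding E_class_eq
  by (rule quotient_class_eq_iff[OF F_subgroup add_subgroup_B_num F_subset_B_num])

lemma E_page_one: "\<one>\<^bsub>E_page C d F r p\<^esub> = E_class C d F r p 0"
  by (simp add: E_page_def FactGroup_def E_class_eq B_page_def quotient_group_carrier coset_def)

lemma E_class_eq_one_iff:
  "E_class C d F r p c = \<one>\<^bsub>E_page C d F r p\<^esub> \<longleftrightarrow> c \<in> B_num C d F r p"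
  using E_class_eq_iff[of r p c 0] by (simp add: E_page_one)

text \<open>Well-definedness of the differential of page \<open>r\<close>: two representatives
  differ by \<open>d b + e\<close> with \<open>e\<close> of level \<open>p - 1\<close>, so their
  boundaries differ by \<open>d e\<close>, which is zero on page \<open>r\<close> in level
  \<open>p - r\<close>.\<close>

lemma E_diff_E_class:
  assumes c: "c \<in> F p" "d c \<in> F (p - real r)" and eq: "E_class C d F r p x = E_class C d F r p c"
  shows "E_diff C d F r p (E_class C d F r p x) = E_class C d F r (p - real r) (d c)"
  unfolding E_diff_def induced_map_def
proof (rule the_equality)
  show "\<exists>c'\<in>{c \<in> F p. d c \<in> F (p - real r)}. E_class C d F r p x = E_class C d F r p c' \<and>
      E_class C d F r (p - real r) (d c) = E_class C d F r (p - real r) (d c')"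
    using assms by blast
next
  fix q' assume "\<exists>c'\<in>{c \<in> F p. d c \<in> F (p - real r)}. E_class C d F r p x = E_class C d F r p c' \<and>
      q' = E_class C d F r (p - real r) (d c')"
  then obtain c' where c': "c' \<in> F p" "d c' \<in> F (p - real r)"
    and "c' - c \<in> B_num C d F r p" and q': "q' = E_class C d F r (p - real r) (d c')"
    using eq by (metis (mono_tags, lifting) E_class_eq_iff mem_Collect_eq)
  then obtain b where b: "b \<in> F (p + real r - 1)" and e: "c' - c - d b \<in> F (p - 1)"
    by (auto simp: mem_B_num)
  have "d (c' - c - d b) = d c' - d c"
    using d_d[OF b] by (simp add: d_diff)
  moreover have "d c' - d c \<in> F (p - real r)"
    using c c' add_subgroup_diff[OF F_subgroup] by blast
  \<comment> \<open>In level \<open>p - r\<close> the page divides by boundaries from level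
    \<open>(p - r) + r - 1 = p - 1\<close>, the level of \<open>c' - c - d b\<close>.\<close>
  ultimately have "d c' - d c \<in> B_num C d F r (p - real r)"
    unfolding mem_B_num using e by (intro bexI[of _ "c' - c - d b"]) (auto simp: add_subgroup_0 F_subgroup)
  then show "q' = E_class C d F r (p - real r) (d c)"
    unfolding q' by (simp add: E_class_eq_iff)
qed

lemma F_le: "c \<in> F p \<Longrightarrow> p \<le> q \<Longrightarrow> c \<in> F q"
  using F_mono by blast

lemma boundaries_antimono: "b' \<le> b \<Longrightarrow> boundaries a b' \<subseteq> boundaries a b"
  using F_mono[of b' b] by (auto simp: boundaries_def)

section \<open>An element whose differential drops one level\<close>

context
  fixes p :: real and x :: 'a
  assumes x: "x \<in> F p" and dx: "d x \<in> F (p - 1)"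
begin

text \<open>The summand \<open>e\<close> of level \<open>p - 1\<close> in \<open>Z_num\<close> is
  the correction of \<open>x\<close>; its boundary has to agree with \<open>d x\<close> up to level
  \<open>p - i\<close>.\<close>

lemma mem_Z_num_iff_boundaries:
  assumes "1 \<le> i"
  shows "x \<in> Z_num C d F i p \<longleftrightarrow> d x \<in> boundaries (p - 1) (p - real i)"
proof -
  have "x - e \<in> F p" if "e \<in> F (p - 1)" for e
    using x F_le[OF that, of p] by (simp add: add_subgroup_diff F_subgroup)
  then show ?thesis
    unfolding mem_Z_num boundaries_def by (auto simp: d_diff)
qed

text \<open>The differential is computed on the corrected representative \<open>x - e\<close>. Its
  value vanishes iff a further correction \<open>b\<close> of level \<open>p - 1\<close> pushes the
  boundary one level lower, and the two corrections add up to one.\<close>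

lemma E_diff_eq_one_iff:
  assumes "1 \<le> i" and "x \<in> Z_num C d F i p"
  shows "E_diff C d F i p (E_class C d F i p x) = \<one>\<^bsub>E_page C d F i (p - real i)\<^esub>
     \<longleftrightarrow> d x \<in> boundaries (p - 1) (p - real i - 1)"
proof -
  obtain e where e: "e \<in> F (p - 1)" and xe: "x - e \<in> F p" "d (x - e) \<in> F (p - real i)"
    using assms(2) by (auto simp: mem_Z_num)
  have "x - (x - e) \<in> B_num C d F i p"
    using e F_subset_B_num by auto
  then have "E_diff C d F i p (E_class C d F i p x) = E_class C d F i (p - real i) (d (x - e))"
    by (intro E_diff_E_class xe) (simp only: E_class_eq_iff)
  then have "?thesis \<longleftrightarrow> (d (x - e) \<in> B_num C d F i (p - real i) \<longleftrightarrow>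
      d x \<in> boundaries (p - 1) (p - real i - 1))"
    by (simp only: E_class_eq_one_iff)
  moreover have "d (x - e) \<in> B_num C d F i (p - real i) \<longleftrightarrow> d x \<in> boundaries (p - 1) (p - real i - 1)"
  proof
    assume "d (x - e) \<in> B_num C d F i (p - real i)"
    then obtain b where "b \<in> F (p - 1)" "d (x - e) - d b \<in> F (p - real i - 1)"
      by (auto simp: mem_B_num)
    then show "d x \<in> boundaries (p - 1) (p - real i - 1)"
      unfolding boundaries_def using e
      by (auto simp: d_diff d_add algebra_simps intro!: bexI[of _ "e + b"] add_subgroup_add F_subgroup)
  next
    assume "d x \<in> boundaries (p - 1) (p - real i - 1)"
    then obtain c where c: "c \<in> F (p - 1)" "d x - d c \<in> F (p - real i - 1)"
      by (auto simp: boundaries_def)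
    \<comment> \<open>\<open>c\<close> is the total correction, so \<open>b\<close> is what remains
      of it after \<open>e\<close>.\<close>
    define b where "b = c - e"
    have b: "b \<in> F (p - 1)"
      unfolding b_def using c e by (simp add: add_subgroup_diff F_subgroup)
    have f: "d (x - e) - d b \<in> F (p - real i - 1)"
      using c by (simp add: b_def d_diff)
    \<comment> \<open>This difference is \<open>d b\<close>; \<open>B_num\<close> also asks for its
      level to be at most \<open>p - i\<close>.\<close>
    then have "d (x - e) - (d (x - e) - d b) \<in> F (p - real i)"
      by (intro add_subgroup_diff F_subgroup xe F_le[OF f]) simp
    then show "d (x - e) \<in> B_num C d F i (p - real i)"
      unfolding mem_B_num using b f by (intro bexI[of _ b]) auto
  qed
  ultimately show ?thesis
    by blast
qed

lemma boundaries_start: "d x \<in> boundaries (p - 1) (p - 1)"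
  using dx F_subset_boundaries by blast

text \<open>Survival to page \<open>i\<close> is the condition at \<open>j = i - 1\<close>, which
  implies those at all smaller \<open>j\<close> because the groups \<open>boundaries\<close> grow
  with their second level.\<close>

lemma survives_iff:
  assumes "1 \<le> i"
  shows "x \<in> Z_num C d F i p \<and>
      E_diff C d F i p (E_class C d F i p x) \<noteq> \<one>\<^bsub>E_page C d F i (p - real i)\<^esub>
    \<longleftrightarrow> d x \<notin> boundaries (p - 1) (p - real i - 1) \<and>
      (\<forall>j. 1 \<le> j \<and> j < i \<longrightarrow> d x \<in> boundaries (p - 1) (p - real j - 1))"
    (is "?L \<longleftrightarrow> ?R")
proof -
  have "d x \<in> boundaries (p - 1) (p - real i) \<longleftrightarrow>
      (\<forall>j. 1 \<le> j \<and> j < i \<longrightarrow> d x \<in> boundaries (p - 1) (p - real j - 1))" (is "_ \<longleftrightarrow> ?all")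
  proof
    assume *: "d x \<in> boundaries (p - 1) (p - real i)"
    show ?all
    proof (intro allI impI)
      fix j :: nat assume "1 \<le> j \<and> j < i"
      then have "p - real i \<le> p - real j - 1"
        by linarith
      then show "d x \<in> boundaries (p - 1) (p - real j - 1)"
        using boundaries_antimono * by blast
    qed
  next
    assume all: ?all
    \<comment> \<open>\<open>k\<close> is the last earlier index. For \<open>k = 0\<close> there is
      none, and the assumption on \<open>d x\<close> itself gives the claim.\<close>
    obtain k where k: "i = Suc k"
      using assms by (cases i) auto
    show "d x \<in> boundaries (p - 1) (p - real i)"
    proof (cases "k = 0")
      case False
      then have "d x \<in> boundaries (p - 1) (p - real k - 1)"
        using all k by simp
      then show ?thesis
        by (simp add: k algebra_simps)
    qed (use boundaries_start k in simp)
  qed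
  then show ?thesis
    using mem_Z_num_iff_boundaries[OF assms] E_diff_eq_one_iff[OF assms] by blast
qed

text \<open>At most one index can qualify, since a later one demands membership where an earlier one
  denies it. The infimum is thus taken over a singleton or the empty set, and it is finite only in
  the first case.\<close>

lemma first_nonzero_diff_eq_iff:
  assumes "1 \<le> i"
  shows "first_nonzero_diff C d F p x = enat i \<longleftrightarrow>
      d x \<notin> boundaries (p - 1) (p - real i - 1) \<and>
      (\<forall>j. 1 \<le> j \<and> j < i \<longrightarrow> d x \<in> boundaries (p - 1) (p - real j - 1))"
proof -
  define R where "R i \<longleftrightarrow> d x \<notin> boundaries (p - 1) (p - real i - 1) \<and>
      (\<forall>j. 1 \<le> j \<and> j < i \<longrightarrow> d x \<in> boundaries (p - 1) (p - real j - 1))" for i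
  let ?S = "{enat i | i. 1 \<le> i \<and> R i}"
  have n: "first_nonzero_diff C d F p x = Inf ?S"
    unfolding first_nonzero_diff_def R_def using survives_iff by (metis (no_types, lifting))
  have unique: "i = j" if "1 \<le> i" "R i" "1 \<le> j" "R j" for i j
    using that unfolding R_def by (meson linorder_less_linear)
  show ?thesis
    unfolding n R_def[symmetric]
  proof
    assume "Inf ?S = enat i"
    then have "?S \<noteq> {}"
      by (auto simp: Inf_enat_def split: if_splits)
    then have "Inf ?S \<in> ?S"
      by (metis (no_types, lifting) Inf_enat_def LeastI ex_in_conv)
    then show "R i"
      using \<open>Inf ?S = enat i\<close> by auto
  next
    assume "R i"
    then have "?S = {enat i}"
      using assms unique by auto
    then show "Inf ?S = enat i"
      by simp
  qed
qed

text \<open>The condition in \<open>B_num\<close> that \<open>d b\<close> have level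
  \<open>p\<close> is automatic: \<open>d b\<close> is \<open>x\<close> minus an element of level
  \<open>p - 1\<close>.\<close>

lemma E_class_eq_one_iff_boundaries:
  assumes "1 \<le> i"
  shows "E_class C d F i p x = \<one>\<^bsub>E_page C d F i p\<^esub> \<longleftrightarrow> x \<in> boundaries (p + real i - 1) (p - 1)"
proof -
  have "d b \<in> F p" if "x - d b \<in> F (p - 1)" for b
    using add_subgroup_diff[OF F_subgroup x F_le[OF that]] by simp
  then show ?thesis
    unfolding E_class_eq_one_iff mem_B_num boundaries_def by blast
qed

end

end

section \<open>Pairs of empty rectangles\<close>

text \<open>Walking upwards from \<open>a\<close> on the circle \<open>\<int>/m\<close>, one meets \<open>b\<close> strictly before \<open>c\<close>.\<close>

definition cyc :: "nat \<Rightarrow> nat \<Rightarrow> nat \<Rightarrow> bool" where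
  "cyc a b c \<longleftrightarrow> a < b \<and> b < c \<or> b < c \<and> c < a \<or> c < a \<and> a < b"

text \<open>The unit interval \<open>[u, u + 1]\<close> lies on the circular arc from \<open>a\<close> to \<open>c\<close>.\<close>

definition arc :: "nat \<Rightarrow> nat \<Rightarrow> nat \<Rightarrow> bool" where
  "arc a c u \<longleftrightarrow> u = a \<or> cyc a u c"

lemma cyc_irrefl [simp]: "\<not> cyc a a c" "\<not> cyc a c c" "\<not> cyc a c a"
  by (auto simp: cyc_def)

text \<open>Collects everything that one cyclic order decides about its three points, as a rewriting
  aid.\<close>

lemma cyc_closure:
  assumes "cyc a b c"
  shows "cyc a b c \<and> cyc b c a \<and> cyc c a b \<and> \<not> cyc a c b \<and> \<not> cyc c b a \<and> \<not> cyc b a c \<and>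
    a \<noteq> b \<and> b \<noteq> c \<and> a \<noteq> c"
  using assms by (auto simp: cyc_def)

lemma cyc_rotate: "cyc a b c \<Longrightarrow> cyc b c a"
  and cyc_asym: "cyc a b c \<Longrightarrow> \<not> cyc a c b"
  and cyc_total: "a \<noteq> b \<Longrightarrow> b \<noteq> c \<Longrightarrow> a \<noteq> c \<Longrightarrow> cyc a b c \<or> cyc a c b"
  by (auto simp: cyc_def)

lemma cyc_split: "cyc a c e \<Longrightarrow> cyc a u e \<longleftrightarrow> cyc a u c \<or> u = c \<or> cyc c u e"
  by (auto simp: cyc_def)

lemma arc_split: "cyc a c e \<Longrightarrow> arc a e u \<longleftrightarrow> arc a c u \<or> arc c e u"
  by (auto simp: cyc_def arc_def)

lemma arc_total: "a \<noteq> c \<Longrightarrow> arc a c u \<or> arc c a u"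
  by (auto simp: cyc_def arc_def)

lemma arc_start: "arc a c a"
  by (simp add: arc_def)

text \<open>
  A state is given by its row function \<open>s\<close> on columns, the markers \<open>O\<close> by a function \<open>t\<close>.
  A rectangle leaving the state \<open>s\<close> is determined by its southwest corner \<open>(a, s a)\<close> and its
  northeast corner \<open>(c, s c)\<close>, hence by an ordered pair of columns, and leads to
  \<open>swap_values s a c\<close>.
\<close>

definition swap_values :: "(nat \<Rightarrow> nat) \<Rightarrow> nat \<Rightarrow> nat \<Rightarrow> nat \<Rightarrow> nat" where
  "swap_values s a c = s(a := s c, c := s a)"

text \<open>State points are lattice points and are tested against the open sides with
  \<open>cyc\<close>; markers sit in cells and are tested against unit intervals with
  \<open>arc\<close>.\<close>

definition free_rect :: "nat \<Rightarrow> (nat \<Rightarrow> nat) \<Rightarrow> (nat \<Rightarrow> nat) \<Rightarrow> nat \<Rightarrow> nat \<Rightarrow> bool" where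
  "free_rect m t s a c \<longleftrightarrow> a < m \<and> c < m \<and> a \<noteq> c \<and>
     (\<forall>u<m. \<not> (cyc a u c \<and> cyc (s a) (s u) (s c))) \<and>
     (\<forall>u<m. \<not> (arc a c u \<and> arc (s a) (s c) (t u)))"

lemma free_rectD:
  assumes "free_rect m t s a c"
  shows "a < m" "c < m" "a \<noteq> c"
    "u < m \<Longrightarrow> \<not> (cyc a u c \<and> cyc (s a) (s u) (s c))"
    "u < m \<Longrightarrow> \<not> (arc a c u \<and> arc (s a) (s c) (t u))"
  using assms by (auto simp: free_rect_def)

lemma swap_values_simps [simp]:
  "swap_values s a c a = s c" "swap_values s a c c = s a"
  "u \<noteq> a \<Longrightarrow> u \<noteq> c \<Longrightarrow> swap_values s a c u = s u"
  by (auto simp: swap_values_def)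

context
  fixes m :: nat and s t :: "nat \<Rightarrow> nat"
  assumes s: "bij_betw s {..<m} {..<m}" and t: "bij_betw t {..<m} {..<m}"
begin

lemma perm_eq_iff: "u < m \<Longrightarrow> v < m \<Longrightarrow> s u = s v \<longleftrightarrow> u = v"
  using s by (auto simp: bij_betw_def inj_on_def)

text \<open>At the corner columns emptiness follows from the cyclic orders. Any other column has, by
  injectivity, a row different from the three corner rows, so arcs may be subdivided there.\<close>

lemma column_cases:
  assumes "u < m" "a < m" "c < m" "e < m"
  obtains "u = a" | "u = c" | "u = e"
    | "u \<noteq> a" "u \<noteq> c" "u \<noteq> e" "s u \<noteq> s a" "s u \<noteq> s c" "s u \<noteq> s e"
  using assms perm_eq_iff by blast

lemma ex_marker_in_row: "v < m \<Longrightarrow> \<exists>u<m. t u = s v"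
  using s t by (metis bij_betw_def bij_betw_iff_bijections lessThan_iff)

text \<open>
  Two successive rectangles that involve exactly three columns form an L-shape, which can be cut
  into two rectangles in exactly one other way. The names say at which corner of the first rectangle
  the second one starts (its southwest corner) or ends (its northeast corner), and how its size
  compares. In each lemma one cyclic order is given; were the other one wrong, the
  two rectangles would cover a whole row or column of cells, hence an \<open>O\<close>.
\<close>

lemma recut_from_se_low:
  assumes 1: "free_rect m t s a c" and 2: "free_rect m t (swap_values s a c) c e" and "a \<noteq> e"
    and h: "cyc (s a) (s e) (s c)"
  shows "free_rect m t s a e \<and> free_rect m t (swap_values s a e) a c \<and> cyc a c e"
proof -
  note free1 = free_rectD[OF 1] and free2 = free_rectD[OF 2]
  have ne: "a \<noteq> c" "c \<noteq> e" "a \<noteq> e" "a < m" "c < m" "e < m"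
    using free1 free2 assms by auto
  \<comment> \<open>Both rectangles contain cells of row \<open>s a\<close>. In the wrong cyclic
    order their column arcs would cover the circle, and the \<open>O\<close> of this row would lie
    in one of them.\<close>
  obtain w where w: "w < m" "t w = s a"
    using ex_marker_in_row ne by blast
  have h': "cyc a c e"
  proof (rule ccontr)
    assume "\<not> cyc a c e"
    then have "arc a c w \<or> arc c e w"
      using ne by (metis cyc_rotate cyc_total arc_split arc_total)
    then show False
      using free1(5)[OF w(1)] free2(5)[OF w(1)] w ne h by (auto simp: arc_def)
  qed
  \<comment> \<open>Three corner columns are settled directly; at any other column both arcs are
    subdivided and the claim follows propositionally from emptiness of the old rectangles.\<close>
  have "\<not> (cyc a u e \<and> cyc (s a) (s u) (s e))" if u: "u < m" for u
    by (rule column_cases[OF u ne(4-6)])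
      ((use ne cyc_closure[OF h] cyc_closure[OF h'] in simp_all)[3],
        use free1(4)[OF u] free2(4)[OF u] ne in \<open>simp add: cyc_split[OF h] cyc_split[OF h']; argo\<close>)
  moreover have "\<not> (arc a e u \<and> arc (s a) (s e) (t u))" if u: "u < m" for u
    using free1(5)[OF u] free2(5)[OF u] ne
    by (simp add: arc_split[OF h] arc_split[OF h']; argo)
  ultimately have free_ae: "free_rect m t s a e"
    using ne by (simp add: free_rect_def)
  have "\<not> (cyc a u c \<and> cyc (swap_values s a e a) (swap_values s a e u) (swap_values s a e c))" if u: "u < m" for u
    by (rule column_cases[OF u ne(4-6)])
      ((use ne cyc_closure[OF h] cyc_closure[OF h'] in simp_all)[3],
        use free1(4)[OF u] free2(4)[OF u] ne in \<open>simp add: cyc_split[OF h] cyc_split[OF h']; argo\<close>)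
  moreover have "\<not> (arc a c u \<and> arc (swap_values s a e a) (swap_values s a e c) (t u))" if u: "u < m" for u
    using free1(5)[OF u] free2(5)[OF u] ne
    by (simp add: arc_split[OF h] arc_split[OF h']; argo)
  ultimately have free_ac: "free_rect m t (swap_values s a e) a c"
    using ne by (simp add: free_rect_def)
  show ?thesis
    using free_ae free_ac h' by blast
qed

lemma recut_from_se_high:
  assumes 1: "free_rect m t s a c" and 2: "free_rect m t (swap_values s a c) c e" and "a \<noteq> e"
    and h: "cyc (s a) (s c) (s e)"
  shows "free_rect m t s c e \<and> free_rect m t (swap_values s c e) a e \<and> cyc a c e"
proof -
  note free1 = free_rectD[OF 1] and free2 = free_rectD[OF 2]
  have ne: "a \<noteq> c" "c \<noteq> e" "a \<noteq> e" "a < m" "c < m" "e < m"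
    using free1 free2 assms by auto
  obtain w where w: "w < m" "t w = s a"
    using ex_marker_in_row ne by blast
  have h': "cyc a c e"
  proof (rule ccontr)
    assume "\<not> cyc a c e"
    then have "arc a c w \<or> arc c e w"
      using ne by (metis cyc_rotate cyc_total arc_split arc_total)
    then show False
      using free1(5)[OF w(1)] free2(5)[OF w(1)] w ne h by (auto simp: arc_def)
  qed
  have "\<not> (cyc c u e \<and> cyc (s c) (s u) (s e))" if u: "u < m" for u
    by (rule column_cases[OF u ne(4-6)])
      ((use ne cyc_closure[OF h] cyc_closure[OF h'] in simp_all)[3],
        use free1(4)[OF u] free2(4)[OF u] ne in \<open>simp add: cyc_split[OF h] cyc_split[OF h']; argo\<close>)
  moreover have "\<not> (arc c e u \<and> arc (s c) (s e) (t u))" if u: "u < m" for u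
    using free1(5)[OF u] free2(5)[OF u] ne
    by (simp add: arc_split[OF h] arc_split[OF h']; argo)
  ultimately have free_ce: "free_rect m t s c e"
    using ne by (simp add: free_rect_def)
  have "\<not> (cyc a u e \<and> cyc (swap_values s c e a) (swap_values s c e u) (swap_values s c e e))" if u: "u < m" for u
    by (rule column_cases[OF u ne(4-6)])
      ((use ne cyc_closure[OF h] cyc_closure[OF h'] in simp_all)[3],
        use free1(4)[OF u] free2(4)[OF u] ne in \<open>simp add: cyc_split[OF h] cyc_split[OF h']; argo\<close>)
  moreover have "\<not> (arc a e u \<and> arc (swap_values s c e a) (swap_values s c e e) (t u))" if u: "u < m" for u
    using free1(5)[OF u] free2(5)[OF u] ne
    by (simp add: arc_split[OF h] arc_split[OF h']; argo)
  ultimately have free_ae: "free_rect m t (swap_values s c e) a e"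
    using ne by (simp add: free_rect_def)
  show ?thesis
    using free_ce free_ae h' by blast
qed

lemma recut_from_nw_narrow:
  assumes 1: "free_rect m t s a c" and 2: "free_rect m t (swap_values s a c) a e" and "c \<noteq> e"
    and h: "cyc a e c"
  shows "free_rect m t s a e \<and> free_rect m t (swap_values s a e) e c \<and> cyc (s a) (s c) (s e)"
proof -
  note free1 = free_rectD[OF 1] and free2 = free_rectD[OF 2]
  have ne: "a \<noteq> c" "c \<noteq> e" "a \<noteq> e" "a < m" "c < m" "e < m"
    using free1 free2 assms by auto
  have sne: "s a \<noteq> s c" "s c \<noteq> s e" "s a \<noteq> s e"
    using ne by (simp_all add: perm_eq_iff)
  have h': "cyc (s a) (s c) (s e)"
  proof (rule ccontr)
    assume "\<not> cyc (s a) (s c) (s e)"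
    \<comment> \<open>Both rectangles contain cells of column \<open>a\<close>, and here the row
      arcs would cover the circle.\<close>
    then have "arc (s a) (s c) (t a) \<or> arc (swap_values s a c a) (swap_values s a c e) (t a)"
      using ne sne by (simp, metis cyc_rotate cyc_total arc_split arc_total)
    then show False
      using free1(5)[of a] free2(5)[of a] ne h by (auto simp: arc_def)
  qed
  have "\<not> (cyc a u e \<and> cyc (s a) (s u) (s e))" if u: "u < m" for u
    by (rule column_cases[OF u ne(4-6)])
      ((use ne cyc_closure[OF h] cyc_closure[OF h'] in simp_all)[3],
        use free1(4)[OF u] free2(4)[OF u] ne in \<open>simp add: cyc_split[OF h] cyc_split[OF h']; argo\<close>)
  moreover have "\<not> (arc a e u \<and> arc (s a) (s e) (t u))" if u: "u < m" for u
    using free1(5)[OF u] free2(5)[OF u] ne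
    by (simp add: arc_split[OF h] arc_split[OF h']; argo)
  ultimately have free_ae: "free_rect m t s a e"
    using ne by (simp add: free_rect_def)
  have "\<not> (cyc e u c \<and> cyc (swap_values s a e e) (swap_values s a e u) (swap_values s a e c))" if u: "u < m" for u
    by (rule column_cases[OF u ne(4-6)])
      ((use ne cyc_closure[OF h] cyc_closure[OF h'] in simp_all)[3],
        use free1(4)[OF u] free2(4)[OF u] ne in \<open>simp add: cyc_split[OF h] cyc_split[OF h']; argo\<close>)
  moreover have "\<not> (arc e c u \<and> arc (swap_values s a e e) (swap_values s a e c) (t u))" if u: "u < m" for u
    using free1(5)[OF u] free2(5)[OF u] ne
    by (simp add: arc_split[OF h] arc_split[OF h']; argo)
  ultimately have free_ec: "free_rect m t (swap_values s a e) e c"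
    using ne by (simp add: free_rect_def)
  show ?thesis
    using free_ae free_ec h' by blast
qed

lemma recut_from_nw_wide:
  assumes 1: "free_rect m t s a c" and 2: "free_rect m t (swap_values s a c) a e" and "c \<noteq> e"
    and h: "cyc a c e"
  shows "free_rect m t s c e \<and> free_rect m t (swap_values s c e) a c \<and> cyc (s a) (s c) (s e)"
proof -
  note free1 = free_rectD[OF 1] and free2 = free_rectD[OF 2]
  have ne: "a \<noteq> c" "c \<noteq> e" "a \<noteq> e" "a < m" "c < m" "e < m"
    using free1 free2 assms by auto
  have sne: "s a \<noteq> s c" "s c \<noteq> s e" "s a \<noteq> s e"
    using ne by (simp_all add: perm_eq_iff)
  have h': "cyc (s a) (s c) (s e)"
  proof (rule ccontr)
    assume "\<not> cyc (s a) (s c) (s e)"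
    then have "arc (s a) (s c) (t a) \<or> arc (swap_values s a c a) (swap_values s a c e) (t a)"
      using ne sne by (simp, metis cyc_rotate cyc_total arc_split arc_total)
    then show False
      using free1(5)[of a] free2(5)[of a] ne h by (auto simp: arc_def)
  qed
  have "\<not> (cyc c u e \<and> cyc (s c) (s u) (s e))" if u: "u < m" for u
    by (rule column_cases[OF u ne(4-6)])
      ((use ne cyc_closure[OF h] cyc_closure[OF h'] in simp_all)[3],
        use free1(4)[OF u] free2(4)[OF u] ne in \<open>simp add: cyc_split[OF h] cyc_split[OF h']; argo\<close>)
  moreover have "\<not> (arc c e u \<and> arc (s c) (s e) (t u))" if u: "u < m" for u
    using free1(5)[OF u] free2(5)[OF u] ne
    by (simp add: arc_split[OF h] arc_split[OF h']; argo)
  ultimately have free_ce: "free_rect m t s c e"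
    using ne by (simp add: free_rect_def)
  have "\<not> (cyc a u c \<and> cyc (swap_values s c e a) (swap_values s c e u) (swap_values s c e c))" if u: "u < m" for u
    by (rule column_cases[OF u ne(4-6)])
      ((use ne cyc_closure[OF h] cyc_closure[OF h'] in simp_all)[3],
        use free1(4)[OF u] free2(4)[OF u] ne in \<open>simp add: cyc_split[OF h] cyc_split[OF h']; argo\<close>)
  moreover have "\<not> (arc a c u \<and> arc (swap_values s c e a) (swap_values s c e c) (t u))" if u: "u < m" for u
    using free1(5)[OF u] free2(5)[OF u] ne
    by (simp add: arc_split[OF h] arc_split[OF h']; argo)
  ultimately have free_ac: "free_rect m t (swap_values s c e) a c"
    using ne by (simp add: free_rect_def)
  show ?thesis
    using free_ce free_ac h' by blast
qed

lemma recut_to_se_wide: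
  assumes 1: "free_rect m t s a c" and 2: "free_rect m t (swap_values s a c) e c" and "a \<noteq> e"
    and h: "cyc e a c"
  shows "free_rect m t s e a \<and> free_rect m t (swap_values s e a) a c \<and> cyc (s e) (s a) (s c)"
proof -
  note free1 = free_rectD[OF 1] and free2 = free_rectD[OF 2]
  have ne: "a \<noteq> c" "c \<noteq> e" "a \<noteq> e" "a < m" "c < m" "e < m"
    using free1 free2 assms by auto
  have sne: "s a \<noteq> s c" "s c \<noteq> s e" "s a \<noteq> s e"
    using ne by (simp_all add: perm_eq_iff)
  have h': "cyc (s e) (s a) (s c)"
  proof (rule ccontr)
    assume "\<not> cyc (s e) (s a) (s c)"
    then have "arc (s a) (s c) (t a) \<or> arc (swap_values s a c e) (swap_values s a c c) (t a)"
      using ne sne by (simp, metis cyc_rotate cyc_total arc_split arc_total)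
    then show False
      using free1(5)[of a] free2(5)[of a] ne h by (auto simp: arc_def)
  qed
  have "\<not> (cyc e u a \<and> cyc (s e) (s u) (s a))" if u: "u < m" for u
    by (rule column_cases[OF u ne(4-6)])
      ((use ne cyc_closure[OF h] cyc_closure[OF h'] in simp_all)[3],
        use free1(4)[OF u] free2(4)[OF u] ne in \<open>simp add: cyc_split[OF h] cyc_split[OF h']; argo\<close>)
  moreover have "\<not> (arc e a u \<and> arc (s e) (s a) (t u))" if u: "u < m" for u
    using free1(5)[OF u] free2(5)[OF u] ne
    by (simp add: arc_split[OF h] arc_split[OF h']; argo)
  ultimately have free_ea: "free_rect m t s e a"
    using ne by (simp add: free_rect_def)
  have "\<not> (cyc a u c \<and> cyc (swap_values s e a a) (swap_values s e a u) (swap_values s e a c))" if u: "u < m" for u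
    by (rule column_cases[OF u ne(4-6)])
      ((use ne cyc_closure[OF h] cyc_closure[OF h'] in simp_all)[3],
        use free1(4)[OF u] free2(4)[OF u] ne in \<open>simp add: cyc_split[OF h] cyc_split[OF h']; argo\<close>)
  moreover have "\<not> (arc a c u \<and> arc (swap_values s e a a) (swap_values s e a c) (t u))" if u: "u < m" for u
    using free1(5)[OF u] free2(5)[OF u] ne
    by (simp add: arc_split[OF h] arc_split[OF h']; argo)
  ultimately have free_ac: "free_rect m t (swap_values s e a) a c"
    using ne by (simp add: free_rect_def)
  show ?thesis
    using free_ea free_ac h' by blast
qed

lemma recut_to_se_narrow:
  assumes 1: "free_rect m t s a c" and 2: "free_rect m t (swap_values s a c) e c" and "a \<noteq> e"
    and h: "cyc a e c"
  shows "free_rect m t s e c \<and> free_rect m t (swap_values s e c) a e \<and> cyc (s e) (s a) (s c)"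
proof -
  note free1 = free_rectD[OF 1] and free2 = free_rectD[OF 2]
  have ne: "a \<noteq> c" "c \<noteq> e" "a \<noteq> e" "a < m" "c < m" "e < m"
    using free1 free2 assms by auto
  have sne: "s a \<noteq> s c" "s c \<noteq> s e" "s a \<noteq> s e"
    using ne by (simp_all add: perm_eq_iff)
  have h': "cyc (s e) (s a) (s c)"
  proof (rule ccontr)
    assume "\<not> cyc (s e) (s a) (s c)"
    \<comment> \<open>The second rectangle starts inside the width of the first, so the common
      column used is \<open>e\<close> instead of \<open>a\<close>.\<close>
    then have "arc (s a) (s c) (t e) \<or> arc (swap_values s a c e) (swap_values s a c c) (t e)"
      using ne sne by (simp, metis cyc_rotate cyc_total arc_split arc_total)
    then show False
      using free1(5)[of e] free2(5)[of e] ne h by (auto simp: arc_def)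
  qed
  have "\<not> (cyc e u c \<and> cyc (s e) (s u) (s c))" if u: "u < m" for u
    by (rule column_cases[OF u ne(4-6)])
      ((use ne cyc_closure[OF h] cyc_closure[OF h'] in simp_all)[3],
        use free1(4)[OF u] free2(4)[OF u] ne in \<open>simp add: cyc_split[OF h] cyc_split[OF h']; argo\<close>)
  moreover have "\<not> (arc e c u \<and> arc (s e) (s c) (t u))" if u: "u < m" for u
    using free1(5)[OF u] free2(5)[OF u] ne
    by (simp add: arc_split[OF h] arc_split[OF h']; argo)
  ultimately have free_ec: "free_rect m t s e c"
    using ne by (simp add: free_rect_def)
  have "\<not> (cyc a u e \<and> cyc (swap_values s e c a) (swap_values s e c u) (swap_values s e c e))" if u: "u < m" for u
    by (rule column_cases[OF u ne(4-6)])
      ((use ne cyc_closure[OF h] cyc_closure[OF h'] in simp_all)[3],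
        use free1(4)[OF u] free2(4)[OF u] ne in \<open>simp add: cyc_split[OF h] cyc_split[OF h']; argo\<close>)
  moreover have "\<not> (arc a e u \<and> arc (swap_values s e c a) (swap_values s e c e) (t u))" if u: "u < m" for u
    using free1(5)[OF u] free2(5)[OF u] ne
    by (simp add: arc_split[OF h] arc_split[OF h']; argo)
  ultimately have free_ae: "free_rect m t (swap_values s e c) a e"
    using ne by (simp add: free_rect_def)
  show ?thesis
    using free_ec free_ae h' by blast
qed

lemma recut_to_nw_high:
  assumes 1: "free_rect m t s a c" and 2: "free_rect m t (swap_values s a c) e a" and "c \<noteq> e"
    and h: "cyc (s e) (s a) (s c)"
  shows "free_rect m t s e a \<and> free_rect m t (swap_values s e a) e c \<and> cyc e a c"
proof -
  note free1 = free_rectD[OF 1] and free2 = free_rectD[OF 2]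
  have ne: "a \<noteq> c" "c \<noteq> e" "a \<noteq> e" "a < m" "c < m" "e < m"
    using free1 free2 assms by auto
  obtain w where w: "w < m" "t w = s a"
    using ex_marker_in_row ne by blast
  have h': "cyc e a c"
  proof (rule ccontr)
    assume "\<not> cyc e a c"
    then have "arc a c w \<or> arc e a w"
      using ne by (metis cyc_rotate cyc_total arc_split arc_total)
    then show False
      using free1(5)[OF w(1)] free2(5)[OF w(1)] w ne h by (auto simp: arc_def)
  qed
  have "\<not> (cyc e u a \<and> cyc (s e) (s u) (s a))" if u: "u < m" for u
    by (rule column_cases[OF u ne(4-6)])
      ((use ne cyc_closure[OF h] cyc_closure[OF h'] in simp_all)[3],
        use free1(4)[OF u] free2(4)[OF u] ne in \<open>simp add: cyc_split[OF h] cyc_split[OF h']; argo\<close>)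
  moreover have "\<not> (arc e a u \<and> arc (s e) (s a) (t u))" if u: "u < m" for u
    using free1(5)[OF u] free2(5)[OF u] ne
    by (simp add: arc_split[OF h] arc_split[OF h']; argo)
  ultimately have free_ea: "free_rect m t s e a"
    using ne by (simp add: free_rect_def)
  have "\<not> (cyc e u c \<and> cyc (swap_values s e a e) (swap_values s e a u) (swap_values s e a c))" if u: "u < m" for u
    by (rule column_cases[OF u ne(4-6)])
      ((use ne cyc_closure[OF h] cyc_closure[OF h'] in simp_all)[3],
        use free1(4)[OF u] free2(4)[OF u] ne in \<open>simp add: cyc_split[OF h] cyc_split[OF h']; argo\<close>)
  moreover have "\<not> (arc e c u \<and> arc (swap_values s e a e) (swap_values s e a c) (t u))" if u: "u < m" for u
    using free1(5)[OF u] free2(5)[OF u] ne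
    by (simp add: arc_split[OF h] arc_split[OF h']; argo)
  ultimately have free_ec: "free_rect m t (swap_values s e a) e c"
    using ne by (simp add: free_rect_def)
  show ?thesis
    using free_ea free_ec h' by blast
qed

lemma recut_to_nw_low:
  assumes 1: "free_rect m t s a c" and 2: "free_rect m t (swap_values s a c) e a" and "c \<noteq> e"
    and h: "cyc (s a) (s e) (s c)"
  shows "free_rect m t s e c \<and> free_rect m t (swap_values s e c) a c \<and> cyc e a c"
proof -
  note free1 = free_rectD[OF 1] and free2 = free_rectD[OF 2]
  have ne: "a \<noteq> c" "c \<noteq> e" "a \<noteq> e" "a < m" "c < m" "e < m"
    using free1 free2 assms by auto
  \<comment> \<open>The second rectangle starts higher than the first, so row \<open>s e\<close> is
    met by both.\<close>
  obtain w where w: "w < m" "t w = s e"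
    using ex_marker_in_row ne by blast
  have h': "cyc e a c"
  proof (rule ccontr)
    assume "\<not> cyc e a c"
    then have "arc a c w \<or> arc e a w"
      using ne by (metis cyc_rotate cyc_total arc_split arc_total)
    then show False
      using free1(5)[OF w(1)] free2(5)[OF w(1)] w ne h by (auto simp: arc_def)
  qed
  have "\<not> (cyc e u c \<and> cyc (s e) (s u) (s c))" if u: "u < m" for u
    by (rule column_cases[OF u ne(4-6)])
      ((use ne cyc_closure[OF h] cyc_closure[OF h'] in simp_all)[3],
        use free1(4)[OF u] free2(4)[OF u] ne in \<open>simp add: cyc_split[OF h] cyc_split[OF h']; argo\<close>)
  moreover have "\<not> (arc e c u \<and> arc (s e) (s c) (t u))" if u: "u < m" for u
    using free1(5)[OF u] free2(5)[OF u] ne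
    by (simp add: arc_split[OF h] arc_split[OF h']; argo)
  ultimately have free_ec: "free_rect m t s e c"
    using ne by (simp add: free_rect_def)
  have "\<not> (cyc a u c \<and> cyc (swap_values s e c a) (swap_values s e c u) (swap_values s e c c))" if u: "u < m" for u
    by (rule column_cases[OF u ne(4-6)])
      ((use ne cyc_closure[OF h] cyc_closure[OF h'] in simp_all)[3],
        use free1(4)[OF u] free2(4)[OF u] ne in \<open>simp add: cyc_split[OF h] cyc_split[OF h']; argo\<close>)
  moreover have "\<not> (arc a c u \<and> arc (swap_values s e c a) (swap_values s e c c) (t u))" if u: "u < m" for u
    using free1(5)[OF u] free2(5)[OF u] ne
    by (simp add: arc_split[OF h] arc_split[OF h']; argo)
  ultimately have free_ac: "free_rect m t (swap_values s e c) a c"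
    using ne by (simp add: free_rect_def)
  show ?thesis
    using free_ec free_ac h' by blast
qed

end

section \<open>Cancellation of paths in pairs\<close>

lemma sum_involution_eq_0:
  fixes f :: "'b \<Rightarrow> 'c::comm_monoid_add"
  assumes "finite S"
    and "\<And>x. x \<in> S \<Longrightarrow> \<phi> x \<in> S \<and> \<phi> (\<phi> x) = x \<and> \<phi> x \<noteq> x \<and> f x + f (\<phi> x) = 0"
  shows "sum f S = 0"
  using assms
proof (induction S rule: finite_psubset_induct)
  case (psubset S)
  show ?case
  proof (cases "S = {}")
    case False
    then obtain x where x: "x \<in> S"
      by blast
    \<comment> \<open>Removing one orbit, whose two terms cancel, leaves a smaller set that the
      involution still preserves.\<close>
    let ?T = "S - {x, \<phi> x}"
    have "sum f ?T = 0"
    proof (rule psubset.IH)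
      show "?T \<subset> S"
        using x by blast
      fix y assume y: "y \<in> ?T"
      then have "\<phi> y \<noteq> x" "\<phi> y \<noteq> \<phi> x"
        using psubset.prems[of y] psubset.prems[OF x] by auto
      then show "\<phi> y \<in> ?T \<and> \<phi> (\<phi> y) = y \<and> \<phi> y \<noteq> y \<and> f y + f (\<phi> y) = 0"
        using psubset.prems[of y] y by auto
    qed
    moreover have "sum f S = sum f {x, \<phi> x} + sum f ?T"
      using psubset.prems[OF x] x psubset.hyps sum.subset_diff[of "{x, \<phi> x}" S f] by (simp add: add.commute)
    ultimately show ?thesis
      using psubset.prems[OF x] by auto
  qed simp
qed

text \<open>A point off the arc from \<open>x\<close> to \<open>z\<close> lies on the complementary
  arc, hence after \<open>z\<close> and before \<open>x\<close>.\<close>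

lemma cyc_extend: "cyc x y z \<Longrightarrow> \<not> cyc x w z \<Longrightarrow> w \<noteq> x \<Longrightarrow> w \<noteq> z \<Longrightarrow> cyc y z w \<and> cyc w x y"
  by (auto simp: cyc_def)

definition free_paths :: "nat \<Rightarrow> (nat \<Rightarrow> nat) \<Rightarrow> (nat \<Rightarrow> nat) \<Rightarrow> ((nat \<times> nat) \<times> nat \<times> nat) set" where
  "free_paths m t s = {((a, c), (a', c')) | a c a' c'.
     free_rect m t s a c \<and> free_rect m t (swap_values s a c) a' c'}"

fun path_end :: "(nat \<Rightarrow> nat) \<Rightarrow> (nat \<times> nat) \<times> nat \<times> nat \<Rightarrow> nat \<Rightarrow> nat" where
  "path_end s ((a, c), (a', c')) = swap_values (swap_values s a c) a' c'"

text \<open>The other way of cutting the domain of a path of two rectangles.\<close>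

fun recut :: "(nat \<Rightarrow> nat) \<Rightarrow> (nat \<times> nat) \<times> nat \<times> nat \<Rightarrow> (nat \<times> nat) \<times> nat \<times> nat" where
  "recut s ((a, c), (a', c')) =
    (if {a, c} \<inter> {a', c'} = {} then ((a', c'), (a, c))
     else if a' = c then (if cyc (s a) (s c') (s c) then ((a, c'), (a, c)) else ((c, c'), (a, c')))
     else if a' = a then (if cyc a c' c then ((a, c'), (c', c)) else ((c, c'), (a, c)))
     else if c' = c then (if cyc a' a c then ((a', a), (a, c)) else ((a', c), (a, a')))
     else (if cyc (s a') (s a) (s c) then ((a', a), (a', c)) else ((a', c), (a, c))))"

context
  fixes m :: nat and s t :: "nat \<Rightarrow> nat"
  assumes s: "bij_betw s {..<m} {..<m}" and t: "bij_betw t {..<m} {..<m}"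
begin

text \<open>Repeating the pair of columns completes the rows to a vertical annulus, which contains
  the \<open>O\<close> of column \<open>a\<close>; reversing it completes the columns to a
  horizontal one, which contains the \<open>O\<close> of row \<open>s a\<close>.\<close>

lemma no_free_annulus:
  assumes "free_rect m t s a c"
  shows "\<not> free_rect m t (swap_values s a c) a c" "\<not> free_rect m t (swap_values s a c) c a"
proof -
  note free1 = free_rectD[OF assms]
  have "s a \<noteq> s c"
    using perm_eq_iff[OF s t] free1 by auto
  then show "\<not> free_rect m t (swap_values s a c) a c"
    using free_rectD(5)[of m t "swap_values s a c" a c a] free1(1) free1(5)[OF free1(1)]
      arc_total[of "s a" "s c" "t a"] by (auto simp: arc_start)
  obtain w where w: "w < m" "t w = s a"
    using ex_marker_in_row[OF s t] free1 by blast
  then show "\<not> free_rect m t (swap_values s a c) c a"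
    using free_rectD(5)[of m t "swap_values s a c" c a w] free1(5)[OF w(1)] arc_total[OF free1(3), of w]
    by (auto simp: arc_start)
qed

text \<open>The order matters only through the corners of the other rectangle, which move when it is
  used.\<close>

lemma free_rects_disjoint_commute:
  assumes 1: "free_rect m t s a c" and 2: "free_rect m t (swap_values s a c) a' c'"
    and disj: "{a, c} \<inter> {a', c'} = {}"
  shows "free_rect m t s a' c'" "free_rect m t (swap_values s a' c') a c"
proof -
  note free1 = free_rectD[OF 1] and free2 = free_rectD[OF 2]
  have ne: "a \<noteq> c" "a' \<noteq> c'" "a \<noteq> a'" "a \<noteq> c'" "c \<noteq> a'" "c \<noteq> c'"
    and lt: "a < m" "c < m" "a' < m" "c' < m"
    using free1(1-3) free2(1-3) disj by auto
  have sne: "s a \<noteq> s c" "s a' \<noteq> s c'" "s a \<noteq> s a'" "s a \<noteq> s c'" "s c \<noteq> s a'" "s c \<noteq> s c'"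
    using ne lt by (simp_all add: perm_eq_iff[OF s t])
  note E1 = free1(4)[OF lt(3)] free1(4)[OF lt(4)] and E2 = free2(4)[OF lt(1)] free2(4)[OF lt(2)]
  have "\<not> (cyc a' u c' \<and> cyc (s a') (s u) (s c'))" if u: "u < m" for u
  proof -
    \<comment> \<open>If \<open>(a, s a)\<close> were inside the second rectangle, \<open>E2\<close>
      would put \<open>c\<close> and \<open>s c\<close> off its sides, and \<open>cyc_extend\<close>
      would place \<open>(c', s c')\<close> inside the first, against \<open>E1\<close>.\<close>
    have "\<not> (cyc a' a c' \<and> cyc (s a') (s a) (s c'))"
      using E1 E2 ne sne by (auto dest: cyc_extend)
    moreover have "\<not> (cyc a' c c' \<and> cyc (s a') (s c) (s c'))"
      using E1 E2 ne sne by (auto dest: cyc_extend)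
    ultimately show ?thesis
      using free2(4)[OF u] ne by (cases "u = a"; cases "u = c") simp_all
  qed
  moreover have "\<not> (arc a' c' u \<and> arc (s a') (s c') (t u))" if u: "u < m" for u
    using free2(5)[OF u] ne by simp
  ultimately show "free_rect m t s a' c'"
    using ne lt by (simp add: free_rect_def)
  have "\<not> (cyc a u c \<and> cyc (s a) (swap_values s a' c' u) (s c))" if u: "u < m" for u
  proof -
    have "\<not> (cyc a a' c \<and> cyc (s a) (s c') (s c))"
      using E1 E2 ne sne by (auto dest: cyc_extend)
    moreover have "\<not> (cyc a c' c \<and> cyc (s a) (s a') (s c))"
      using E1 E2 ne sne by (auto dest: cyc_extend)
    ultimately show ?thesis
      using free1(4)[OF u] ne by (cases "u = a'"; cases "u = c'") simp_all
  qed
  moreover have "\<not> (arc a c u \<and> arc (s a) (s c) (t u))" if u: "u < m" for u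
    using free1(5)[OF u] .
  ultimately show "free_rect m t (swap_values s a' c') a c"
    using ne lt by (simp add: free_rect_def)
qed

text \<open>The extra cyclic order supplied by each recutting lemma selects the branch of
  \<open>recut\<close> that leads back. The new path differs from the old one already in its first
  rectangle.\<close>

lemma recut:
  assumes "\<pi> \<in> free_paths m t s"
  shows "recut s \<pi> \<in> free_paths m t s \<and> recut s (recut s \<pi>) = \<pi> \<and> recut s \<pi> \<noteq> \<pi> \<and>
    path_end s (recut s \<pi>) = path_end s \<pi>"
proof -
  obtain a c a' c' where \<pi>: "\<pi> = ((a, c), (a', c'))"
    and 1: "free_rect m t s a c" and 2: "free_rect m t (swap_values s a c) a' c'"
    using assms by (auto simp: free_paths_def)
  have ne: "a \<noteq> c" "a' \<noteq> c'" and lt: "a < m" "c < m" "a' < m" "c' < m"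
    using free_rectD(1-3)[OF 1] free_rectD(1-3)[OF 2] by auto
  have ann: "\<not> (a' = a \<and> c' = c)" "\<not> (a' = c \<and> c' = a)"
    using no_free_annulus[OF 1] 2 by auto
  have cyc_s: "cyc (s x) (s z) (s y)" if "\<not> cyc (s x) (s y) (s z)" "x \<noteq> y" "y \<noteq> z" "x \<noteq> z"
    "x < m" "y < m" "z < m" for x y z
    using that cyc_total[of "s x" "s y" "s z"] by (simp add: perm_eq_iff[OF s t])
  \<comment> \<open>Sharing both columns is excluded by \<open>ann\<close>. Sharing one can happen
    in four ways, each with two cyclic orders.\<close>
  consider "{a, c} \<inter> {a', c'} = {}"
    | "a' = c" "a \<noteq> c'" "cyc (s a) (s c') (s c)" | "a' = c" "a \<noteq> c'" "cyc (s a) (s c) (s c')"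
    | "a' = a" "c \<noteq> c'" "cyc a c' c" | "a' = a" "c \<noteq> c'" "cyc a c c'"
    | "c' = c" "a' \<noteq> a" "cyc a' a c" | "c' = c" "a' \<noteq> a" "cyc a a' c"
    | "c' = a" "a' \<noteq> c" "cyc (s a') (s a) (s c)" | "c' = a" "a' \<noteq> c" "cyc (s a) (s a') (s c)"
    using ne lt ann cyc_s[of a c' c] cyc_total[of a c' c] cyc_total[of a' a c] cyc_s[of a' a c]
      cyc_rotate by blast
  then show ?thesis
  proof cases
    case h: 1
    have L: "free_rect m t s a' c' \<and> free_rect m t (swap_values s a' c') a c"
      using free_rects_disjoint_commute[of a c a' c'] 1 2 h ne by blast
    then show ?thesis
      using ne h
      by (auto simp: \<pi> free_paths_def swap_values_def fun_eq_iff dest: cyc_asym)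
  next
    case h: 2
    have L: "free_rect m t s a c' \<and> free_rect m t (swap_values s a c') a c \<and> cyc a c c'"
      using recut_from_se_low[OF s t, of a c c'] 1 2 h ne by auto
    then show ?thesis
      using ne h cyc_closure[OF h(3)] cyc_closure[of a c c']
      by (auto simp: \<pi> free_paths_def swap_values_def fun_eq_iff dest: cyc_asym)
  next
    case h: 3
    have L: "free_rect m t s c c' \<and> free_rect m t (swap_values s c c') a c' \<and> cyc a c c'"
      using recut_from_se_high[OF s t, of a c c'] 1 2 h ne by auto
    then show ?thesis
      using ne h cyc_closure[OF h(3)] cyc_closure[of a c c']
      by (auto simp: \<pi> free_paths_def swap_values_def fun_eq_iff dest: cyc_asym)
  next
    case h: 4
    have L: "free_rect m t s a c' \<and> free_rect m t (swap_values s a c') c' c \<and> cyc (s a) (s c) (s c')"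
      using recut_from_nw_narrow[OF s t, of a c c'] 1 2 h ne by auto
    then show ?thesis
      using ne h cyc_closure[OF h(3)] cyc_closure[of "s a" "s c" "s c'"]
      by (auto simp: \<pi> free_paths_def swap_values_def fun_eq_iff dest: cyc_asym)
  next
    case h: 5
    have L: "free_rect m t s c c' \<and> free_rect m t (swap_values s c c') a c \<and> cyc (s a) (s c) (s c')"
      using recut_from_nw_wide[OF s t, of a c c'] 1 2 h ne by auto
    then show ?thesis
      using ne h cyc_closure[OF h(3)] cyc_closure[of "s a" "s c" "s c'"]
      by (auto simp: \<pi> free_paths_def swap_values_def fun_eq_iff dest: cyc_asym)
  next
    case h: 6
    have L: "free_rect m t s a' a \<and> free_rect m t (swap_values s a' a) a c \<and> cyc (s a') (s a) (s c)"
      using recut_to_se_wide[OF s t, of a c a'] 1 2 h ne by auto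
    then show ?thesis
      using ne h cyc_closure[OF h(3)] cyc_closure[of "s a'" "s a" "s c"]
      by (auto simp: \<pi> free_paths_def swap_values_def fun_eq_iff dest: cyc_asym)
  next
    case h: 7
    have L: "free_rect m t s a' c \<and> free_rect m t (swap_values s a' c) a a' \<and> cyc (s a') (s a) (s c)"
      using recut_to_se_narrow[OF s t, of a c a'] 1 2 h ne by auto
    then show ?thesis
      using ne h cyc_closure[OF h(3)] cyc_closure[of "s a'" "s a" "s c"]
      by (auto simp: \<pi> free_paths_def swap_values_def fun_eq_iff dest: cyc_asym)
  next
    case h: 8
    have L: "free_rect m t s a' a \<and> free_rect m t (swap_values s a' a) a' c \<and> cyc a' a c"
      using recut_to_nw_high[OF s t, of a c a'] 1 2 h ne by auto
    then show ?thesis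
      using ne h cyc_closure[OF h(3)] cyc_closure[of a' a c]
      by (auto simp: \<pi> free_paths_def swap_values_def fun_eq_iff dest: cyc_asym)
  next
    case h: 9
    have L: "free_rect m t s a' c \<and> free_rect m t (swap_values s a' c) a c \<and> cyc a' a c"
      using recut_to_nw_low[OF s t, of a c a'] 1 2 h ne by auto
    then show ?thesis
      using ne h cyc_closure[OF h(3)] cyc_closure[of a' a c]
      by (auto simp: \<pi> free_paths_def swap_values_def fun_eq_iff dest: cyc_asym)
  qed
qed

lemma sum_free_paths_eq_0:
  fixes f :: "(nat \<Rightarrow> nat) \<Rightarrow> 'c::comm_monoid_add"
  assumes "\<And>r. f r + f r = 0"
  shows "(\<Sum>\<pi>\<in>free_paths m t s. f (path_end s \<pi>)) = 0"
proof (rule sum_involution_eq_0[where \<phi> = "recut s"])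
  have "free_paths m t s \<subseteq> ({..<m} \<times> {..<m}) \<times> {..<m} \<times> {..<m}"
    by (auto simp: free_paths_def free_rect_def)
  then show "finite (free_paths m t s)"
    by (rule finite_subset) simp
qed (use recut assms in simp)

end

section \<open>Rectangles as pairs of columns\<close>

definition free_pairs :: "nat \<Rightarrow> (nat \<Rightarrow> nat) \<Rightarrow> (nat \<Rightarrow> nat) \<Rightarrow> (nat \<times> nat) set" where
  "free_pairs m t s = {(a, c). free_rect m t s a c}"

lemma finite_free_pairs: "finite (free_pairs m t s)"
  by (rule finite_subset[of _ "{..<m} \<times> {..<m}"]) (auto simp: free_pairs_def free_rect_def)

section \<open>States as graphs of permutations\<close>

definition graph_on :: "nat \<Rightarrow> (nat \<Rightarrow> nat) \<Rightarrow> (nat \<times> nat) set" where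
  "graph_on m s = (\<lambda>u. (u, s u)) ` {..<m}"

lemma mem_graph_on [simp]: "(u, v) \<in> graph_on m s \<longleftrightarrow> u < m \<and> v = s u"
  by (auto simp: graph_on_def)

lemma one_per_line_graph_on:
  assumes "bij_betw s {..<m} {..<m}"
  shows "one_per_line m (graph_on m s)"
  unfolding one_per_line_def
proof (intro conjI allI impI)
  show "graph_on m s \<subseteq> {..<m} \<times> {..<m}"
    using assms by (auto simp: graph_on_def bij_betw_def)
  show "\<exists>!i. (i, j) \<in> graph_on m s" if "j < m" for j
    using assms that by (simp add: bij_betw_def inj_on_def) (metis image_iff lessThan_iff)
qed simp

text \<open>Uniqueness in columns makes \<open>P\<close> the graph of a function; uniqueness and
  existence in rows make the function bijective.\<close>

lemma one_per_lineE:
  assumes "one_per_line m P"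
  obtains s where "bij_betw s {..<m} {..<m}" "P = graph_on m s"
proof -
  have sub: "P \<subseteq> {..<m} \<times> {..<m}" and ex: "\<And>i. i < m \<Longrightarrow> \<exists>!j. (i, j) \<in> P"
    and row: "\<And>j. j < m \<Longrightarrow> \<exists>!i. (i, j) \<in> P"
    using assms by (auto simp: one_per_line_def)
  define s where "s i = (THE j. (i, j) \<in> P)" for i
  have s: "(i, j) \<in> P \<longleftrightarrow> i < m \<and> j = s i" for i j
    using theI'[OF ex, of i] ex[of i] sub unfolding s_def by blast
  have "bij_betw s {..<m} {..<m}"
    unfolding bij_betw_def inj_on_def
  proof (intro conjI ballI impI Set.set_eqI iffI)
    fix i k assume "i \<in> {..<m}" "k \<in> {..<m}" "s i = s k"
    then have "(i, s i) \<in> P" "(k, s i) \<in> P" "s i < m"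
      using s sub by auto
    then show "i = k"
      using row by blast
  next
    fix j assume "j \<in> s ` {..<m}"
    then show "j \<in> {..<m}"
      using s sub by auto
  next
    fix j assume "j \<in> {..<m}"
    then obtain i where "(i, j) \<in> P"
      using row[of j] by auto
    then show "j \<in> s ` {..<m}"
      using s by auto
  qed
  moreover have "P = graph_on m s"
    using s by auto
  ultimately show thesis
    by (rule that)
qed

lemma graph_on_subset_imp_eq:
  assumes "graph_on m r \<subseteq> graph_on m s"
  shows "graph_on m r = graph_on m s"
proof -
  have "r u = s u" if "u < m" for u
    using subsetD[OF assms, of "(u, r u)"] that by simp
  then show ?thesis
    unfolding graph_on_def by (intro image_cong) simp_all
qed

text \<open>Exchanging two values is precomposition with a transposition.\<close>

lemma bij_betw_swap_values:
  assumes "bij_betw s {..<m} {..<m}" "a < m" "c < m"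
  shows "bij_betw (swap_values s a c) {..<m} {..<m}"
proof -
  let ?\<tau> = "\<lambda>u. if u = a then c else if u = c then a else u"
  have "bij_betw ?\<tau> {..<m} {..<m}"
    by (rule bij_betw_byWitness[where f' = ?\<tau>]) (use assms in auto)
  then have "bij_betw (s \<circ> ?\<tau>) {..<m} {..<m}"
    using assms(1) by (rule bij_betw_trans)
  moreover have "s \<circ> ?\<tau> = swap_values s a c"
    by (auto simp: swap_values_def)
  ultimately show ?thesis
    by simp
qed

text \<open>Translates offsets modulo \<open>m\<close>, by which torus rectangles are given, into
  cyclic order.\<close>

lemma mod_arc:
  assumes "a < m" "0 < w" "w < m" "u < m"
  shows "(\<exists>i<w. u = (a + i) mod m) \<longleftrightarrow> arc a ((a + w) mod m) u"
    and "(\<exists>i. 0 < i \<and> i < w \<and> u = (a + i) mod m) \<longleftrightarrow> cyc a u ((a + w) mod m)"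
    and "(a + w) mod m \<noteq> a"
proof -
  have md: "(a + i) mod m = (if a + i < m then a + i else a + i - m)" if "i < m" for i
    using assms that by (simp add: mod_if)
  \<comment> \<open>The number of unit steps upwards around the circle from \<open>a\<close> to
    \<open>u\<close>.\<close>
  define k where "k = (if a \<le> u then u - a else u + m - a)"
  have k: "k < m" and uk: "u = (a + i) mod m \<longleftrightarrow> i = k" if "i < m" for i
    using assms that by (auto simp: md k_def)
  have "k < w \<longleftrightarrow> arc a ((a + w) mod m) u" "0 < k \<and> k < w \<longleftrightarrow> cyc a u ((a + w) mod m)"
    using assms by (auto simp: md k_def arc_def cyc_def split: if_splits)
  then show "(\<exists>i<w. u = (a + i) mod m) \<longleftrightarrow> arc a ((a + w) mod m) u"
    "(\<exists>i. 0 < i \<and> i < w \<and> u = (a + i) mod m) \<longleftrightarrow> cyc a u ((a + w) mod m)"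
    using uk assms(3) by (metis less_trans)+
  show "(a + w) mod m \<noteq> a"
    using assms by (auto simp: md)
qed

definition arc_length :: "nat \<Rightarrow> nat \<Rightarrow> nat \<Rightarrow> nat" where
  "arc_length m a c = (if a \<le> c then c - a else c + m - a)"

lemma arc_length:
  assumes "a < m" "c < m" "a \<noteq> c"
  shows "0 < arc_length m a c" "arc_length m a c < m" "(a + arc_length m a c) mod m = c"
  using assms by (auto simp: arc_length_def mod_if)

lemma arc_length_add_mod:
  assumes "a < m" "0 < w" "w < m"
  shows "arc_length m a ((a + w) mod m) = w"
  using assms by (auto simp: arc_length_def mod_if)

definition rect_between :: "nat \<Rightarrow> (nat \<Rightarrow> nat) \<Rightarrow> nat \<Rightarrow> nat \<Rightarrow> rectangle" where
  "rect_between m s a c =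
     \<lparr>left = a, bottom = s a, width = arc_length m a c, height = arc_length m (s a) (s c)\<rparr>"

section \<open>Torus rectangles and the differential in terms of columns\<close>

context
  fixes G :: grid and m :: nat and t :: "nat \<Rightarrow> nat"
  assumes m: "m = grid_size G" and O: "Os G = graph_on m t" and t: "bij_betw t {..<m} {..<m}"
begin

context
  fixes s :: "nat \<Rightarrow> nat"
  assumes s: "bij_betw s {..<m} {..<m}"
begin

lemma perm_less: "u < m \<Longrightarrow> s u < m" and marker_less: "u < m \<Longrightarrow> t u < m"
  using s t by (auto simp: bij_betw_def)

text \<open>Cells and interior points of \<open>r\<close> are products of arcs by
  \<open>mod_arc\<close>. Meeting a graph then becomes a condition on single columns.\<close>

lemma free_rect_iff_torus:
  assumes "torus_rectangle G r" "bottom r = s (left r)"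
    and c: "c = (left r + width r) mod m" and "s c = (bottom r + height r) mod m"
  shows "free_rect m t s (left r) c \<longleftrightarrow>
     rect_interior_points G r \<inter> graph_on m s = {} \<and> rect_cells G r \<inter> Os G = {}"
proof -
  have r: "left r < m" "bottom r < m" "0 < width r" "width r < m" "0 < height r" "height r < m"
    using assms(1) by (auto simp: torus_rectangle_def m)
  have "(u, v) \<in> rect_cells G r \<longleftrightarrow> arc (left r) c u \<and> arc (bottom r) (s c) v" if "u < m" "v < m" for u v
    using mod_arc(1)[OF r(1,3,4) that(1)] mod_arc(1)[OF r(2,5,6) that(2)] assms
    by (auto simp: rect_cells_def torus_point_def m)
  then have 1: "rect_cells G r \<inter> Os G = {} \<longleftrightarrow> (\<forall>u<m. \<not> (arc (left r) c u \<and> arc (s (left r)) (s c) (t u)))"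
    using marker_less assms(2) by (fastforce simp: O)
  have "(u, v) \<in> rect_interior_points G r \<longleftrightarrow> cyc (left r) u c \<and> cyc (bottom r) v (s c)"
    if "u < m" "v < m" for u v
    using mod_arc(2)[OF r(1,3,4) that(1)] mod_arc(2)[OF r(2,5,6) that(2)] assms
    by (auto simp: rect_interior_points_def torus_point_def m)
  then have 2: "rect_interior_points G r \<inter> graph_on m s = {} \<longleftrightarrow>
      (\<forall>u<m. \<not> (cyc (left r) u c \<and> cyc (s (left r)) (s u) (s c)))"
    using perm_less assms(2) by fastforce
  have "c < m" "left r \<noteq> c"
    using r mod_arc(3)[OF r(1,3,4) r(1)] c by auto
  then show ?thesis
    unfolding 1 2 free_rect_def using r(1) by blast
qed

lemma rect_between_in_rects:
  assumes "a < m" "c < m" "a \<noteq> c"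
  shows "rect_between m s a c \<in> rects G (graph_on m s) (graph_on m (swap_values s a c))"
proof -
  let ?x = "graph_on m s" and ?y = "graph_on m (swap_values s a c)"
  have sne: "s a \<noteq> s c"
    using assms s by (auto simp: bij_betw_def inj_on_def)
  have sl: "s a < m" "s c < m"
    using perm_less assms by auto
  note A = arc_length[OF assms] and B = arc_length[OF sl sne]
  have corners: "sw_corner G (rect_between m s a c) = (a, s a)" "ne_corner G (rect_between m s a c) = (c, s c)"
    "se_corner G (rect_between m s a c) = (c, s a)" "nw_corner G (rect_between m s a c) = (a, s c)"
    using A B assms sl
    by (simp_all add: sw_corner_def ne_corner_def se_corner_def nw_corner_def torus_point_def
        rect_between_def flip: m)
  have "?x \<inter> ?y = ?x - {(a, s a), (c, s c)}"
    using sne by (auto simp: swap_values_def split: if_splits)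
  moreover have "card ?x = m"
    unfolding graph_on_def by (simp add: card_image inj_on_def)
  ultimately have "card (?x \<inter> ?y) = m - 2"
    using assms by (simp add: card_Diff_subset graph_on_def)
  moreover have "{(a, s a), (c, s a), (a, s c), (c, s c)} = (?x - ?y) \<union> (?y - ?x)"
    using sne assms by (auto simp: swap_values_def split: if_splits)
  moreover have "2 \<le> m"
    using assms by linarith
  ultimately show ?thesis
    using assms A B sl by (simp add: rects_def corners torus_rectangle_def flip: m)
      (simp add: rect_between_def)
qed

text \<open>The two corners in the initial state fix the rows of \<open>r\<close>, and the symmetric
  difference then fixes \<open>y\<close>: it suffices that \<open>y\<close>, itself a graph,
  contains the swapped graph.\<close>

lemma rectsD:
  assumes r: "r \<in> rects G (graph_on m s) y" and y: "one_per_line m y"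
  defines "c \<equiv> (left r + width r) mod m"
  shows "torus_rectangle G r" "bottom r = s (left r)" "s c = (bottom r + height r) mod m"
    "y = graph_on m (swap_values s (left r) c)" "r = rect_between m s (left r) c"
proof -
  let ?x = "graph_on m s"
  let ?a = "left r"
  show tr: "torus_rectangle G r"
    using r by (auto simp: rects_def)
  then have b: "?a < m" "bottom r < m" "0 < width r" "width r < m" "0 < height r" "height r < m"
    by (auto simp: torus_rectangle_def m)
  have xy: "{sw_corner G r, se_corner G r, nw_corner G r, ne_corner G r} = (?x - y) \<union> (y - ?x)"
    and ne: "ne_corner G r \<in> ?x" and sw: "sw_corner G r \<in> ?x"
    using r by (auto simp: rects_def)
  show sa: "bottom r = s ?a"
    using sw b by (simp add: sw_corner_def torus_point_def flip: m)
  show sc: "s c = (bottom r + height r) mod m"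
    using ne b by (simp add: ne_corner_def torus_point_def c_def flip: m)
  have c: "c < m" "?a \<noteq> c"
    using mod_arc(3)[OF b(1,3,4) b(1)] b by (auto simp: c_def)
  then have sne: "s ?a \<noteq> s c"
    using b s by (auto simp: bij_betw_def inj_on_def)
  have xy': "{(?a, s ?a), (c, s ?a), (?a, s c), (c, s c)} = (?x - y) \<union> (y - ?x)"
    using xy b unfolding sc by (simp add: sw_corner_def se_corner_def nw_corner_def ne_corner_def
        torus_point_def sa c_def flip: m)
  have "graph_on m (swap_values s ?a c) \<subseteq> y"
  proof
    fix z assume "z \<in> graph_on m (swap_values s ?a c)"
    then obtain u where u: "u < m" "z = (u, swap_values s ?a c u)"
      by (auto simp: graph_on_def)
    have "(c, s ?a) \<in> (?x - y) \<union> (y - ?x)" "(?a, s c) \<in> (?x - y) \<union> (y - ?x)"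
      unfolding xy'[symmetric] by simp_all
    then have "(c, s ?a) \<in> y" "(?a, s c) \<in> y"
      using sne by auto
    \<comment> \<open>A point of the state missing from \<open>y\<close> belongs to the symmetric
      difference, so it is a corner.\<close>
    moreover have "u = ?a \<or> u = c" if "(u, s u) \<notin> y"
    proof -
      have "(u, s u) \<in> (?x - y) \<union> (y - ?x)"
        using that u(1) by simp
      then show ?thesis
        unfolding xy'[symmetric] by auto
    qed
    ultimately show "z \<in> y"
      using u(2) by (auto simp: swap_values_def)
  qed
  then show "y = graph_on m (swap_values s ?a c)"
    using y graph_on_subset_imp_eq by (metis one_per_lineE)
  have "arc_length m ?a c = width r" "arc_length m (s ?a) (s c) = height r"
    using arc_length_add_mod b sa sc by (auto simp: c_def)
  then show "r = rect_between m s ?a c"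
    using sa by (simp add: rect_between_def)
qed

text \<open>Taking the columns of the left and right edges is a bijection, with inverse
  \<open>rect_between\<close>.\<close>

lemma card_free_rects:
  assumes "y \<in> grid_states G"
  shows "card {r \<in> empty_rects G (graph_on m s) y. rect_cells G r \<inter> Os G = {}} =
    card {p \<in> free_pairs m t s. graph_on m (swap_values s (fst p) (snd p)) = y}"
    (is "card ?R = card ?P")
proof (rule bij_betw_same_card)
  let ?f = "\<lambda>r. (left r, (left r + width r) mod m)" and ?g = "\<lambda>p. rect_between m s (fst p) (snd p)"
  have y: "one_per_line m y"
    using assms by (simp add: grid_states_def m)
  show "bij_betw ?f ?R ?P"
  proof (rule bij_betw_byWitness[where f' = ?g])
    show "\<forall>r\<in>?R. ?g (?f r) = r"
      using rectsD(5)[OF _ y] by (auto simp: empty_rects_def)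
    show "?f ` ?R \<subseteq> ?P"
    proof
      fix p assume "p \<in> ?f ` ?R"
      then obtain r where r: "r \<in> rects G (graph_on m s) y" "p = ?f r"
        and e: "rect_interior_points G r \<inter> graph_on m s = {}" "rect_cells G r \<inter> Os G = {}"
        by (auto simp: empty_rects_def)
      show "p \<in> ?P"
        using free_rect_iff_torus[OF rectsD(1,2)[OF r(1) y] refl rectsD(3)[OF r(1) y]] e
          rectsD(4)[OF r(1) y] by (simp add: r(2) free_pairs_def)
    qed
    have *: "left (?g p) = fst p" "(left (?g p) + width (?g p)) mod m = snd p" "?g p \<in> ?R"
      if p: "p \<in> ?P" for p
    proof -
      obtain a c where ac: "p = (a, c)"
        by fastforce
      have fr: "free_rect m t s a c" and "graph_on m (swap_values s a c) = y"
        using p by (auto simp: ac free_pairs_def)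
      moreover have b: "a < m" "c < m" "a \<noteq> c"
        using free_rectD(1-3)[OF fr] .
      ultimately have r: "?g p \<in> rects G (graph_on m s) y"
        using rect_between_in_rects[OF b] by (simp add: ac)
      show l: "left (?g p) = fst p" and c: "(left (?g p) + width (?g p)) mod m = snd p"
        using arc_length[OF b] by (simp_all add: ac rect_between_def)
      show "?g p \<in> ?R"
        using free_rect_iff_torus[OF rectsD(1,2)[OF r y] refl rectsD(3)[OF r y]] fr r
        unfolding c unfolding l by (simp add: empty_rects_def ac)
    qed
    show "\<forall>p\<in>?P. ?f (?g p) = p"
      using * by (simp add: prod_eq_iff)
    show "?g ` ?P \<subseteq> ?R"
      using * by blast
  qed
qed

lemma swapped_state: "p \<in> free_pairs m t s \<Longrightarrow> graph_on m (swap_values s (fst p) (snd p)) \<in> grid_states G"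
  using one_per_line_graph_on[OF bij_betw_swap_values[OF s]]
  by (auto simp: grid_states_def free_pairs_def free_rect_def simp flip: m)

lemma finite_grid_states: "finite (grid_states G)"
  by (rule finite_subset[of _ "Pow ({..<m} \<times> {..<m})"])
    (auto simp: grid_states_def one_per_line_def m)

lemma state_diff_graph_on:
  "state_diff G (graph_on m s) =
    (\<Sum>p\<in>free_pairs m t s. state_chain (graph_on m (swap_values s (fst p) (snd p))))"
proof -
  \<comment> \<open>Turns a count modulo 2 into a sum with one term per rectangle, so that the sums
    over end states can be merged.\<close>
  have single_of_nat: "Poly_Mapping.single y (of_nat (card A) :: bit) = (\<Sum>_\<in>A. state_chain y)"
    if "finite A" for y and A :: "(nat \<times> nat) set"
    using that
  proof (induction A)
    case (insert p A)
    have "Poly_Mapping.single y (of_nat (Suc (card A)) :: bit) =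
        state_chain y + Poly_Mapping.single y (of_nat (card A))"
      unfolding of_nat_Suc single_add state_chain_def ..
    then show ?case
      using insert by simp
  qed simp
  have "state_diff G (graph_on m s) =
      (\<Sum>y\<in>grid_states G. \<Sum>p | p \<in> free_pairs m t s \<and> graph_on m (swap_values s (fst p) (snd p)) = y.
        state_chain (graph_on m (swap_values s (fst p) (snd p))))"
    unfolding state_diff_def
  proof (rule sum.cong[OF refl])
    fix y assume y: "y \<in> grid_states G"
    let ?P = "{p \<in> free_pairs m t s. graph_on m (swap_values s (fst p) (snd p)) = y}"
    have "Poly_Mapping.single y (of_nat (card ?P) :: bit) = (\<Sum>p\<in>?P. state_chain y)"
      by (rule single_of_nat) (simp add: finite_free_pairs)
    also have "\<dots> = (\<Sum>p\<in>?P. state_chain (graph_on m (swap_values s (fst p) (snd p))))"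
      by (rule sum.cong) auto
    finally show "Poly_Mapping.single y (of_nat (card {r \<in> empty_rects G (graph_on m s) y.
        rect_cells G r \<inter> Os G = {}}) :: bit) =
      (\<Sum>p | p \<in> free_pairs m t s \<and> graph_on m (swap_values s (fst p) (snd p)) = y.
        state_chain (graph_on m (swap_values s (fst p) (snd p))))"
      using card_free_rects[OF y] by simp
  qed
  also have "\<dots> = (\<Sum>p\<in>free_pairs m t s. state_chain (graph_on m (swap_values s (fst p) (snd p))))"
    using swapped_state by (intro sum.group finite_free_pairs finite_grid_states) blast
  finally show ?thesis .
qed

end
end

section \<open>The Alexander grading along a rectangle\<close>

lemma real_I_count:
  assumes "finite P" "finite Q"
  shows "real (I_count P Q) = (\<Sum>p\<in>P. \<Sum>q\<in>Q. of_bool (fst p < fst q \<and> snd p < snd q))"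
proof -
  have "{(p, q). p \<in> P \<and> q \<in> Q \<and> fst p < fst q \<and> snd p < snd q} =
      (P \<times> Q) \<inter> {z. fst (fst z) < fst (snd z) \<and> snd (fst z) < snd (snd z)}"
    by auto
  then have "real (I_count P Q) =
      (\<Sum>z\<in>P \<times> Q. of_bool (fst (fst z) < fst (snd z) \<and> snd (fst z) < snd (snd z)))"
    using assms by (simp add: I_count_def)
  then show ?thesis
    by (simp only: sum.cartesian_product case_prod_unfold)
qed

text \<open>The contribution to twice \<open>J_count\<close> of the marker in cell
  \<open>(v, q)\<close> and the lattice point \<open>(i, j)\<close>. The half-integer shift turns
  one strict comparison into a weak one.\<close>

definition comparable :: "nat \<Rightarrow> nat \<Rightarrow> nat \<Rightarrow> nat \<Rightarrow> real" where
  "comparable v q i j = of_bool (i \<le> v \<and> j \<le> q) + of_bool (v < i \<and> q < j)"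

lemma J_count_graph_on:
  "2 * J_count (state_points (graph_on m s)) (marker_points (graph_on m p)) =
    (\<Sum>v<m. \<Sum>u<m. comparable v (p v) u (s u))"
proof -
  let ?f = "\<lambda>u. (real u, real (s u))" and ?g = "\<lambda>v. (real v + 1 / 2, real (p v) + 1 / 2)"
  have S: "state_points (graph_on m s) = ?f ` {..<m}" and P: "marker_points (graph_on m p) = ?g ` {..<m}"
    by (auto simp: state_points_def marker_points_def graph_on_def image_image)
  have inj: "inj_on ?f {..<m}" "inj_on ?g {..<m}"
    by (auto simp: inj_on_def)
  have half: "real i < real v + 1 / 2 \<longleftrightarrow> i \<le> v" "real v + 1 / 2 < real i \<longleftrightarrow> v < i" for i v
    by linarith+
  have "real (I_count (?f ` {..<m}) (?g ` {..<m})) = (\<Sum>v<m. \<Sum>u<m. of_bool (u \<le> v \<and> s u \<le> p v))"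
    using inj by (subst sum.swap) (simp add: real_I_count sum.reindex half del: sum_of_bool_eq)
  moreover have "real (I_count (?g ` {..<m}) (?f ` {..<m})) = (\<Sum>v<m. \<Sum>u<m. of_bool (v < u \<and> p v < s u))"
    using inj by (simp add: real_I_count sum.reindex half del: sum_of_bool_eq)
  ultimately show ?thesis
    by (simp add: J_count_def S P comparable_def sum.distrib del: sum_of_bool_eq)
qed

definition wrap :: "nat \<Rightarrow> nat \<Rightarrow> real" where
  "wrap a c = of_bool (c < a)"

text \<open>
  The indicator of an arc differs from a difference of two indicators of half-lines by the constant
  \<open>wrap\<close>. After summation over the markers this correction no longer depends on them, because
  there is one marker in each row and column; it cancels between \<open>O\<close> and \<open>X\<close>.
\<close>

lemma comparable_swap:
  assumes "a \<noteq> c" "b \<noteq> e"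
  shows "comparable v q a b + comparable v q c e - comparable v q a e - comparable v q c b =
    2 * ((of_bool (arc a c v) - wrap a c) * (of_bool (arc b e q) - wrap b e))"
proof -
  have arc: "of_bool (arc x z w) - wrap x z = of_bool (x \<le> w) - (of_bool (z \<le> w) :: real)" if "x \<noteq> z" for x z w
    using that by (auto simp: arc_def cyc_def wrap_def)
  \<comment> \<open>With half-line indicators \<open>f\<close> and \<open>g\<close> this is
    \<open>f * g + (1 - f) * (1 - g)\<close>; in the alternating sum only the mixed term
    \<open>2 * f * g\<close> survives, and it factors.\<close>
  have cmp: "comparable v q i j =
      of_bool (i \<le> v) * of_bool (j \<le> q) + (1 - of_bool (i \<le> v)) * (1 - of_bool (j \<le> q))" for i j
    by (auto simp: comparable_def)
  show ?thesis
    unfolding arc[OF assms(1)] arc[OF assms(2)] cmp by (simp only: algebra_simps)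
qed

text \<open>\<open>K\<close> is obtained before \<open>p\<close> is chosen, so the same constant
  serves both kinds of markers.\<close>

lemma J_count_swap_values:
  assumes s: "bij_betw s {..<m} {..<m}" and ac: "a < m" "c < m" "a \<noteq> c"
  obtains K where "\<And>p. bij_betw p {..<m} {..<m} \<Longrightarrow>
    J_count (state_points (graph_on m s)) (marker_points (graph_on m p)) -
    J_count (state_points (graph_on m (swap_values s a c))) (marker_points (graph_on m p)) =
    real (card {v. v < m \<and> arc a c v \<and> arc (s a) (s c) (p v)}) - K"
proof
  fix p assume p: "bij_betw p {..<m} {..<m}"
  let ?s' = "swap_values s a c"
  let ?w = "wrap a c" and ?w' = "wrap (s a) (s c)"
  let ?h = "\<lambda>v. of_bool (arc a c v) :: real" and ?h' = "\<lambda>q. of_bool (arc (s a) (s c) q) :: real"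
  have sne: "s a \<noteq> s c"
    using s ac by (auto simp: bij_betw_def inj_on_def)
  have *: "(\<Sum>u<m. comparable v q u (s u)) - (\<Sum>u<m. comparable v q u (?s' u)) =
      2 * ((?h v - ?w) * (?h' q - ?w'))" for v q
  proof -
    have split: "(\<Sum>u<m. f u) = f a + f c + (\<Sum>u\<in>{..<m} - {a, c}. f u)" for f :: "nat \<Rightarrow> real"
      using ac sum.subset_diff[of "{a, c}" "{..<m}" f] by simp
    have "(\<Sum>u\<in>{..<m} - {a, c}. comparable v q u (s u)) = (\<Sum>u\<in>{..<m} - {a, c}. comparable v q u (?s' u))"
      by (rule sum.cong) auto
    then show ?thesis
      using comparable_swap[OF ac(3) sne, of v q]
      unfolding split[of "\<lambda>u. comparable v q u (s u)"] split[of "\<lambda>u. comparable v q u (?s' u)"]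
      by simp
  qed
  have "2 * (J_count (state_points (graph_on m s)) (marker_points (graph_on m p)) -
    J_count (state_points (graph_on m ?s')) (marker_points (graph_on m p))) =
    (\<Sum>v<m. 2 * ((?h v - ?w) * (?h' (p v) - ?w')))"
    by (simp only: right_diff_distrib[of 2 "J_count _ _"] J_count_graph_on sum_subtractf[symmetric]
        flip: *)
  then have "J_count (state_points (graph_on m s)) (marker_points (graph_on m p)) -
    J_count (state_points (graph_on m ?s')) (marker_points (graph_on m p)) =
    (\<Sum>v<m. (?h v - ?w) * (?h' (p v) - ?w'))"
    unfolding sum_distrib_left[symmetric] by simp
  \<comment> \<open>Only the first sum couples rows with columns and counts the markers in the
    rectangle. In the third, reindexing by the bijection \<open>p\<close> removes
    \<open>p\<close>.\<close>
  also have "\<dots> = (\<Sum>v<m. ?h v * ?h' (p v)) - ?w' * (\<Sum>v<m. ?h v) - ?w * (\<Sum>v<m. ?h' (p v)) + real m * ?w * ?w'"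
    by (simp add: algebra_simps sum.distrib sum_subtractf sum_distrib_left del: sum_of_bool_eq)
  also have "(\<Sum>v<m. ?h' (p v)) = (\<Sum>v<m. ?h' v)"
    using p by (rule sum.reindex_bij_betw)
  also have "(\<Sum>v<m. ?h v * ?h' (p v)) = real (card {v. v < m \<and> arc a c v \<and> arc (s a) (s c) (p v)})"
  proof -
    have "{v. v < m \<and> arc a c v \<and> arc (s a) (s c) (p v)} =
        {..<m} \<inter> {v. arc a c v \<and> arc (s a) (s c) (p v)}"
      by auto
    then show ?thesis
      by (simp flip: of_bool_conj)
  qed
  finally show "J_count (state_points (graph_on m s)) (marker_points (graph_on m p)) -
    J_count (state_points (graph_on m ?s')) (marker_points (graph_on m p)) =
    real (card {v. v < m \<and> arc a c v \<and> arc (s a) (s c) (p v)}) -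
    (?w' * (\<Sum>v<m. ?h v) + ?w * (\<Sum>v<m. ?h' v) - real m * ?w * ?w')"
    by (simp del: sum_of_bool_eq)
qed

text \<open>The terms pairing a state with itself cancel between \<open>O\<close> and
  \<open>X\<close>; those pairing markers with markers, and the component count, cancel between the
  two states.\<close>

lemma alexander_swap_values:
  assumes m: "m = grid_size G" and O: "Os G = graph_on m t" and X: "Xs G = graph_on m \<xi>"
    and t: "bij_betw t {..<m} {..<m}" and \<xi>: "bij_betw \<xi> {..<m} {..<m}"
    and s: "bij_betw s {..<m} {..<m}" and ac: "a < m" "c < m" "a \<noteq> c"
  shows "alexander G (graph_on m s) - alexander G (graph_on m (swap_values s a c)) =
    real (card {v. v < m \<and> arc a c v \<and> arc (s a) (s c) (\<xi> v)}) -
    real (card {v. v < m \<and> arc a c v \<and> arc (s a) (s c) (t v)})"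
proof -
  obtain K where K: "\<And>p. bij_betw p {..<m} {..<m} \<Longrightarrow>
    J_count (state_points (graph_on m s)) (marker_points (graph_on m p)) -
    J_count (state_points (graph_on m (swap_values s a c))) (marker_points (graph_on m p)) =
    real (card {v. v < m \<and> arc a c v \<and> arc (s a) (s c) (p v)}) - K"
    using J_count_swap_values[OF s ac] by blast
  show ?thesis
    using K[OF t] K[OF \<xi>] by (simp add: alexander_def maslov_wrt_def O X field_simps)
qed

lemma alexander_free_rect:
  assumes m: "m = grid_size G" and O: "Os G = graph_on m t" and X: "Xs G = graph_on m \<xi>"
    and t: "bij_betw t {..<m} {..<m}" and \<xi>: "bij_betw \<xi> {..<m} {..<m}"
    and s: "bij_betw s {..<m} {..<m}" and f: "free_rect m t s a c"
  shows "alexander G (graph_on m (swap_values s a c)) \<le> alexander G (graph_on m s)"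
    and "v < m \<Longrightarrow> arc a c v \<Longrightarrow> arc (s a) (s c) (\<xi> v) \<Longrightarrow>
      alexander G (graph_on m (swap_values s a c)) \<le> alexander G (graph_on m s) - 1"
proof -
  have "{v. v < m \<and> arc a c v \<and> arc (s a) (s c) (t v)} = {}"
    using free_rectD(5)[OF f] by blast
  then have *: "alexander G (graph_on m s) - alexander G (graph_on m (swap_values s a c)) =
      real (card {v. v < m \<and> arc a c v \<and> arc (s a) (s c) (\<xi> v)})"
    using alexander_swap_values[OF m O X t \<xi> s free_rectD(1-3)[OF f]] by simp
  then show "alexander G (graph_on m (swap_values s a c)) \<le> alexander G (graph_on m s)"
    by linarith
  show "alexander G (graph_on m (swap_values s a c)) \<le> alexander G (graph_on m s) - 1"
    if "v < m" "arc a c v" "arc (s a) (s c) (\<xi> v)"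
  proof -
    have "card {v. v < m \<and> arc a c v \<and> arc (s a) (s c) (\<xi> v)} \<noteq> 0"
      using that by auto
    then show ?thesis
      using * by linarith
  qed
qed

section \<open>The filtered grid complex\<close>

lemma add_subgroup_sum:
  assumes "add_subgroup W" "\<And>x. x \<in> S \<Longrightarrow> f x \<in> W"
  shows "sum f S \<in> W"
  using assms(2)
  by (induction S rule: infinite_finite_induct) (auto simp: add_subgroup_0 add_subgroup_add assms(1))

lemma chain_add_self: "(c :: chain) + c = 0"
  by (rule poly_mapping_eqI) (simp add: lookup_add)

text \<open>Allows differentials of several chains to be compared over one index set.\<close>

lemma grid_diff_superset:
  assumes "finite S" "Poly_Mapping.keys c \<subseteq> S"
  shows "grid_diff G c = (\<Sum>x\<in>S. if Poly_Mapping.lookup c x = 0 then 0 else state_diff G x)"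
  unfolding grid_diff_def using assms
  by (intro sum.mono_neutral_cong_left) (auto simp: in_keys_iff)

lemma grid_diff_diff: "grid_diff G (b - c) = grid_diff G b - grid_diff G c"
proof -
  let ?S = "Poly_Mapping.keys b \<union> Poly_Mapping.keys c"
  have minus: "- v = v" for v :: chain
    using chain_add_self[of v] by (simp add: minus_unique)
  have "grid_diff G (b - c) =
      (\<Sum>x\<in>?S. if Poly_Mapping.lookup (b - c) x = 0 then 0 else state_diff G x)"
    by (rule grid_diff_superset) (auto simp: in_keys_iff lookup_minus)
  \<comment> \<open>Over \<open>bit\<close> two nonzero coefficients are equal and cancel; if only
    the one of \<open>c\<close> is nonzero, the sign is absorbed by \<open>minus\<close>.\<close>
  also have "\<dots> = (\<Sum>x\<in>?S. (if Poly_Mapping.lookup b x = 0 then 0 else state_diff G x) -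
      (if Poly_Mapping.lookup c x = 0 then 0 else state_diff G x))"
    by (rule sum.cong) (auto simp: lookup_minus minus)
  also have "\<dots> = grid_diff G b - grid_diff G c"
    using grid_diff_superset[of ?S b G] grid_diff_superset[of ?S c G] by (simp add: sum_subtractf)
  finally show ?thesis .
qed

lemma grid_diff_sum: "grid_diff G (\<Sum>i\<in>I. f i) = (\<Sum>i\<in>I. grid_diff G (f i))"
proof -
  have "grid_diff G 0 = 0"
    by (simp add: grid_diff_def)
  moreover have "grid_diff G (b + c) = grid_diff G b + grid_diff G c" for b c
    using grid_diff_diff[of G "b + c" c] by (simp add: algebra_simps)
  ultimately show ?thesis
    by (induction I rule: infinite_finite_induct) auto
qed

lemma grid_diff_state_chain: "grid_diff G (state_chain x) = state_diff G x"
  by (simp add: grid_diff_def state_chain_def)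

lemma add_subgroup_alexander_filtration: "add_subgroup (alexander_filtration G p)"
  unfolding add_subgroup_def alexander_filtration_def grid_chains_def
  using keys_diff by fastforce

lemma state_chain_mem_filtration:
  "state_chain x \<in> alexander_filtration G p \<longleftrightarrow> x \<in> grid_states G \<and> alexander G x \<le> p"
  by (auto simp: alexander_filtration_def grid_chains_def state_chain_def)

lemma graph_on_reindex:
  assumes "bij_betw \<sigma> {..<m} {..<m}"
  shows "(\<lambda>u. (\<sigma> u, f u)) ` {..<m} = graph_on m (f \<circ> inv_into {..<m} \<sigma>)"
proof -
  have "graph_on m (f \<circ> inv_into {..<m} \<sigma>) = (\<lambda>c. (c, (f \<circ> inv_into {..<m} \<sigma>) c)) ` \<sigma> ` {..<m}"
    using assms by (simp add: graph_on_def bij_betw_def)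
  also have "\<dots> = (\<lambda>u. (\<sigma> u, f u)) ` {..<m}"
    unfolding image_image using assms by (intro image_cong) (auto simp: bij_betw_def)
  finally show ?thesis ..
qed

lemma bij_betw_Suc_mod: "bij_betw (\<lambda>u. (u + 1) mod m) {..<m} {..<m :: nat}"
  by (rule bij_betw_byWitness[where f' = "\<lambda>u. if u = 0 then m - 1 else u - 1"])
    (auto simp: mod_if)

text \<open>The unit interval ending at \<open>v + 1\<close> is the last one of every arc that ends
  there.\<close>

lemma arc_predecessor:
  assumes "a < m" "v < m" "a \<noteq> (v + 1) mod m"
  shows "arc a ((v + 1) mod m) v"
  using assms by (auto simp: arc_def cyc_def mod_if split: if_splits)

section \<open>The complex of a fixed grid diagram\<close>

locale grid_complex =
  fixes G :: grid
  assumes grid_diagram: "grid_diagram G"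
begin

abbreviation "gsize \<equiv> grid_size G"

lemma ex_O: "\<exists>t. bij_betw t {..<gsize} {..<gsize} \<and> Os G = graph_on gsize t"
  and ex_X: "\<exists>\<xi>. bij_betw \<xi> {..<gsize} {..<gsize} \<and> Xs G = graph_on gsize \<xi>"
  using grid_diagram by (auto simp: grid_diagram_def elim!: one_per_lineE)

text \<open>Gives the row of the \<open>O\<close> in a column; the choice is determined only on
  columns below \<open>gsize\<close>.\<close>

definition ocol :: "nat \<Rightarrow> nat" where
  "ocol = (SOME t. bij_betw t {..<gsize} {..<gsize} \<and> Os G = graph_on gsize t)"

definition xcol :: "nat \<Rightarrow> nat" where
  "xcol = (SOME \<xi>. bij_betw \<xi> {..<gsize} {..<gsize} \<and> Xs G = graph_on gsize \<xi>)"

lemma ocol: "bij_betw ocol {..<gsize} {..<gsize}" "Os G = graph_on gsize ocol"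
  using someI_ex[OF ex_O] by (simp_all add: ocol_def)

lemma xcol: "bij_betw xcol {..<gsize} {..<gsize}" "Xs G = graph_on gsize xcol"
  using someI_ex[OF ex_X] by (simp_all add: xcol_def)

lemma grid_statesE:
  assumes "x \<in> grid_states G"
  obtains s where "bij_betw s {..<gsize} {..<gsize}" "x = graph_on gsize s"
  using assms by (auto simp: grid_states_def elim: one_per_lineE)

lemma graph_on_grid_states: "bij_betw s {..<gsize} {..<gsize} \<Longrightarrow> graph_on gsize s \<in> grid_states G"
  by (simp add: grid_states_def one_per_line_graph_on)

lemmas state_diff = state_diff_graph_on[OF refl ocol(2,1)]

lemma free_pairs_bij:
  assumes "bij_betw s {..<gsize} {..<gsize}" "(a, c) \<in> free_pairs gsize ocol s"
  shows "bij_betw (swap_values s a c) {..<gsize} {..<gsize}" "free_rect gsize ocol s a c"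
  using assms bij_betw_swap_values[OF assms(1)] by (auto simp: free_pairs_def free_rect_def)

text \<open>The double sum runs over paths of two free rectangles and depends only on their ends, so
  recutting cancels it.\<close>

lemma grid_diff_state_diff:
  assumes "x \<in> grid_states G"
  shows "grid_diff G (state_diff G x) = 0"
proof -
  obtain s where s: "bij_betw s {..<gsize} {..<gsize}" and x: "x = graph_on gsize s"
    using assms by (rule grid_statesE)
  let ?F = "free_pairs gsize ocol"
  have "grid_diff G (state_diff G x) =
      (\<Sum>p\<in>?F s. \<Sum>q\<in>?F (swap_values s (fst p) (snd p)). state_chain (graph_on gsize (path_end s (p, q))))"
    unfolding x state_diff[OF s] grid_diff_sum grid_diff_state_chain
    by (rule sum.cong) (auto simp: state_diff[OF free_pairs_bij(1)[OF s]] intro!: sum.cong)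
  also have "\<dots> = (\<Sum>\<pi>\<in>Sigma (?F s) (\<lambda>p. ?F (swap_values s (fst p) (snd p))).
      state_chain (graph_on gsize (path_end s \<pi>)))"
    by (subst sum.Sigma) (auto simp: finite_free_pairs case_prod_unfold)
  also have "Sigma (?F s) (\<lambda>p. ?F (swap_values s (fst p) (snd p))) = free_paths gsize ocol s"
    by (auto simp: free_paths_def free_pairs_def)
  also have "(\<Sum>\<pi>\<in>free_paths gsize ocol s. state_chain (graph_on gsize (path_end s \<pi>))) = 0"
    using chain_add_self by (rule sum_free_paths_eq_0[OF s ocol(1)])
  finally show ?thesis .
qed

lemma state_diff_mem_filtration:
  assumes s: "bij_betw s {..<gsize} {..<gsize}"
    and "\<And>a c. free_rect gsize ocol s a c \<Longrightarrow> alexander G (graph_on gsize (swap_values s a c)) \<le> p"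
  shows "state_diff G (graph_on gsize s) \<in> alexander_filtration G p"
  unfolding state_diff[OF s]
proof (rule add_subgroup_sum[OF add_subgroup_alexander_filtration])
  fix q assume "q \<in> free_pairs gsize ocol s"
  then show "state_chain (graph_on gsize (swap_values s (fst q) (snd q))) \<in> alexander_filtration G p"
    using assms(2) free_pairs_bij[OF s, of "fst q" "snd q"] graph_on_grid_states
    by (simp add: state_chain_mem_filtration)
qed

sublocale filtered_complex "grid_chains G" "grid_diff G" "alexander_filtration G"
proof
  show "x \<otimes>\<^bsub>grid_chains G\<^esub> y = x + y" for x y
    by (simp add: grid_chains_def)
  show "add_subgroup (alexander_filtration G p)" for p
    by (rule add_subgroup_alexander_filtration)
  show "alexander_filtration G p \<subseteq> alexander_filtration G q" if "p \<le> q" for p q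
    using that by (fastforce simp: alexander_filtration_def)
  show "grid_diff G (b - c) = grid_diff G b - grid_diff G c" for b c
    by (rule grid_diff_diff)
  fix p c assume c: "c \<in> alexander_filtration G p"
  then have keys: "x \<in> grid_states G" "alexander G x \<le> p" if "x \<in> Poly_Mapping.keys c" for x
    using that by (auto simp: alexander_filtration_def grid_chains_def)
  show "grid_diff G c \<in> alexander_filtration G p"
    unfolding grid_diff_def
  proof (rule add_subgroup_sum[OF add_subgroup_alexander_filtration])
    fix x assume x: "x \<in> Poly_Mapping.keys c"
    then obtain s where s: "bij_betw s {..<gsize} {..<gsize}" "x = graph_on gsize s"
      using keys grid_statesE by blast
    show "state_diff G x \<in> alexander_filtration G p"
      unfolding s(2)
    proof (rule state_diff_mem_filtration[OF s(1)])
      fix a c assume "free_rect gsize ocol s a c"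
      then have "alexander G (graph_on gsize (swap_values s a c)) \<le> alexander G (graph_on gsize s)"
        by (rule alexander_free_rect(1)[OF refl ocol(2) xcol(2) ocol(1) xcol(1) s(1)])
      then show "alexander G (graph_on gsize (swap_values s a c)) \<le> p"
        using keys(2)[OF x] s(2) by simp
    qed
  qed
  show "grid_diff G (grid_diff G c) = 0"
    unfolding grid_diff_def[of G c] grid_diff_sum by (rule sum.neutral) (simp add: grid_diff_state_diff keys)
qed

text \<open>If every rectangle leaving the state contains an \<open>X\<close>, each term of the
  differential has its Alexander grading lowered by at least one.\<close>

lemma state_diff_drops:
  assumes s: "bij_betw s {..<gsize} {..<gsize}"
    and X: "\<And>a c. a < gsize \<Longrightarrow> c < gsize \<Longrightarrow> a \<noteq> c \<Longrightarrow>
      \<exists>v<gsize. arc a c v \<and> arc (s a) (s c) (xcol v)"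
  shows "state_diff G (graph_on gsize s) \<in> alexander_filtration G (alexander G (graph_on gsize s) - 1)"
proof (rule state_diff_mem_filtration[OF s])
  fix a c assume f: "free_rect gsize ocol s a c"
  then obtain v where "v < gsize" "arc a c v" "arc (s a) (s c) (xcol v)"
    using X free_rectD(1-3)[OF f] by blast
  then show "alexander G (graph_on gsize (swap_values s a c)) \<le> alexander G (graph_on gsize s) - 1"
    by (rule alexander_free_rect(2)[OF refl ocol(2) xcol(2) ocol(1) xcol(1) s f])
qed

lemma x_plus:
  "x_plus G \<in> grid_states G"
  "state_diff G (x_plus G) \<in> alexander_filtration G (alexander G (x_plus G) - 1)"
proof -
  define \<sigma> where "\<sigma> u = (u + 1) mod gsize" for u
  have \<sigma>: "bij_betw \<sigma> {..<gsize} {..<gsize}"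
    unfolding \<sigma>_def by (rule bij_betw_Suc_mod)
  \<comment> \<open>Both coordinates are shifted: over column \<open>\<sigma> u\<close> the state
    has row \<open>\<sigma> (xcol u)\<close>.\<close>
  define s where "s = (\<sigma> \<circ> xcol) \<circ> inv_into {..<gsize} \<sigma>"
  have s: "bij_betw s {..<gsize} {..<gsize}"
    unfolding s_def by (intro bij_betw_trans[OF bij_betw_inv_into[OF \<sigma>]] bij_betw_trans[OF xcol(1)] \<sigma>)
  have "x_plus G = (\<lambda>u. (\<sigma> u, (\<sigma> \<circ> xcol) u)) ` {..<gsize}"
    by (simp add: x_plus_def xcol(2) graph_on_def image_image torus_point_def \<sigma>_def)
  then have x: "x_plus G = graph_on gsize s"
    using graph_on_reindex[OF \<sigma>, of "\<sigma> \<circ> xcol"] by (simp add: s_def)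
  show "x_plus G \<in> grid_states G"
    unfolding x using s by (rule graph_on_grid_states)
  show "state_diff G (x_plus G) \<in> alexander_filtration G (alexander G (x_plus G) - 1)"
    unfolding x
  proof (rule state_diff_drops[OF s])
    fix a c assume ac: "a < gsize" "c < gsize" "a \<noteq> c"
    \<comment> \<open>\<open>v\<close> is the column just left of \<open>c\<close>. Its
      \<open>X\<close> has northeast corner \<open>(c, s c)\<close>, so it lies in the northeast
      corner cell of the rectangle.\<close>
    define v where "v = inv_into {..<gsize} \<sigma> c"
    have v: "v < gsize" "\<sigma> v = c"
      using bij_betw_inv_into_right[OF \<sigma>, of c] bij_betwE[OF bij_betw_inv_into[OF \<sigma>]] ac
      by (auto simp: v_def)
    have sc: "s c = \<sigma> (xcol v)"
      by (simp add: s_def v_def)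
    have "s a \<noteq> s c" "s a < gsize" "xcol v < gsize"
      using bij_betw_imp_inj_on[OF s] bij_betwE[OF s] bij_betwE[OF xcol(1)] ac v(1)
      by (auto dest: inj_onD)
    then have "arc a c v" "arc (s a) (s c) (xcol v)"
      using arc_predecessor[of a gsize v] arc_predecessor[of "s a" gsize "xcol v"] ac v
      by (simp_all add: sc \<sigma>_def)
    then show "\<exists>v<gsize. arc a c v \<and> arc (s a) (s c) (xcol v)"
      using v(1) by blast
  qed
qed

lemma x_minus:
  "x_minus G \<in> grid_states G"
  "state_diff G (x_minus G) \<in> alexander_filtration G (alexander G (x_minus G) - 1)"
proof -
  have x: "x_minus G = graph_on gsize xcol"
    unfolding x_minus_def xcol(2) graph_on_def image_image
    using bij_betwE[OF xcol(1)] by (intro image_cong) (auto simp: torus_point_def)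
  show "x_minus G \<in> grid_states G"
    unfolding x using xcol(1) by (rule graph_on_grid_states)
  show "state_diff G (x_minus G) \<in> alexander_filtration G (alexander G (x_minus G) - 1)"
    \<comment> \<open>The witness is \<open>v = a\<close>: the \<open>X\<close> of this column
      occupies the southwest corner cell.\<close>
    unfolding x by (rule state_diff_drops[OF xcol(1)]) (blast intro: arc_start)
qed

text \<open>Stated for any state whose differential drops a level, so that it covers both
  distinguished states.\<close>

lemma spectral_sequence_state:
  assumes x: "x \<in> grid_states G"
    and dx: "state_diff G x \<in> alexander_filtration G (alexander G x - 1)"
    and A: "A = alexander G x" and i: "1 \<le> i"
  shows "first_nonzero_diff (grid_chains G) (grid_diff G) (alexander_filtration G) A (state_chain x)
      = enat i \<longleftrightarrow>
      grid_H_class G (A - 1) (A - real i - 1) (grid_diff G (state_chain x))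
        \<noteq> \<one>\<^bsub>grid_H G (A - 1) (A - real i - 1)\<^esub> \<and>
      (\<forall>j. 1 \<le> j \<and> j < i \<longrightarrow>
        grid_H_class G (A - 1) (A - real j - 1) (grid_diff G (state_chain x))
          = \<one>\<^bsub>grid_H G (A - 1) (A - real j - 1)\<^esub>)"
    and "E_class (grid_chains G) (grid_diff G) (alexander_filtration G) i A (state_chain x)
        = \<one>\<^bsub>grid_E G i A\<^esub> \<longleftrightarrow>
      grid_H_class G (A + real i - 1) (A - 1) (state_chain x) = \<one>\<^bsub>grid_H G (A + real i - 1) (A - 1)\<^esub>"
proof -
  have "state_chain x \<in> alexander_filtration G A"
    "grid_diff G (state_chain x) \<in> alexander_filtration G (A - 1)"
    using x dx by (simp_all add: A state_chain_mem_filtration grid_diff_state_chain)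
  note * = first_nonzero_diff_eq_iff[OF this i] E_class_eq_one_iff_boundaries[OF this i]
  show "first_nonzero_diff (grid_chains G) (grid_diff G) (alexander_filtration G) A (state_chain x)
      = enat i \<longleftrightarrow>
      grid_H_class G (A - 1) (A - real i - 1) (grid_diff G (state_chain x))
        \<noteq> \<one>\<^bsub>grid_H G (A - 1) (A - real i - 1)\<^esub> \<and>
      (\<forall>j. 1 \<le> j \<and> j < i \<longrightarrow>
        grid_H_class G (A - 1) (A - real j - 1) (grid_diff G (state_chain x))
          = \<one>\<^bsub>grid_H G (A - 1) (A - real j - 1)\<^esub>)"
    "E_class (grid_chains G) (grid_diff G) (alexander_filtration G) i A (state_chain x)
        = \<one>\<^bsub>grid_E G i A\<^esub> \<longleftrightarrow>
      grid_H_class G (A + real i - 1) (A - 1) (state_chain x) = \<one>\<^bsub>grid_H G (A + real i - 1) (A - 1)\<^esub>"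
    unfolding grid_H_class_def grid_H_def grid_E_def quotient_homology_class_eq_one_iff
    by (fact *)+
qed

end

theorem proposition1p10:
  fixes G :: grid and i :: nat and A A' :: real
  assumes "grid_diagram G"
    and "A = alexander G (x_plus G)"
    and "A' = alexander G (x_minus G)"
    and "1 \<le> i"
  shows
    "(n_plus G = enat i \<longleftrightarrow>
        (grid_H_class G (A - 1) (A - real i - 1) (grid_diff G (state_chain (x_plus G)))
           \<noteq> \<one>\<^bsub>grid_H G (A - 1) (A - real i - 1)\<^esub> \<and>
         (\<forall>j. 1 \<le> j \<and> j < i \<longrightarrow>
            grid_H_class G (A - 1) (A - real j - 1) (grid_diff G (state_chain (x_plus G)))
              = \<one>\<^bsub>grid_H G (A - 1) (A - real j - 1)\<^esub>))) \<and>
     (enat i < n_plus G \<longrightarrow>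
        (lambda_plus G i = \<one>\<^bsub>grid_E G i A\<^esub> \<longleftrightarrow>
         grid_H_class G (A + real i - 1) (A - 1) (state_chain (x_plus G))
           = \<one>\<^bsub>grid_H G (A + real i - 1) (A - 1)\<^esub>)) \<and>
     (n_minus G = enat i \<longleftrightarrow>
        (grid_H_class G (A' - 1) (A' - real i - 1) (grid_diff G (state_chain (x_minus G)))
           \<noteq> \<one>\<^bsub>grid_H G (A' - 1) (A' - real i - 1)\<^esub> \<and>
         (\<forall>j. 1 \<le> j \<and> j < i \<longrightarrow>
            grid_H_class G (A' - 1) (A' - real j - 1) (grid_diff G (state_chain (x_minus G)))
              = \<one>\<^bsub>grid_H G (A' - 1) (A' - real j - 1)\<^esub>))) \<and>
     (enat i < n_minus G \<longrightarrow>
        (lambda_minus G i = \<one>\<^bsub>grid_E G i A'\<^esub> \<longleftrightarrow>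
         grid_H_class G (A' + real i - 1) (A' - 1) (state_chain (x_minus G))
           = \<one>\<^bsub>grid_H G (A' + real i - 1) (A' - 1)\<^esub>))"
proof -
  interpret grid_complex G
    using assms(1) by unfold_locales
  show ?thesis
    unfolding n_plus_def n_minus_def lambda_plus_def lambda_minus_def assms(2,3)[symmetric]
    by (intro conjI impI spectral_sequence_state x_plus x_minus assms(2-4))
qed

end
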